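(* Let $d\ge3$ and consider a $d$-dimensional random walk with internal states satisfying the basic assumptions (i)–(iv). Then the weak law of large numbers holds for the number of visited sites: for every $\varepsilon>0$, $$P\bigl(|L_d(n)-E_d(n)|>\varepsilon E_d(n)\bigr)\to0\qquad(n\to\infty).$$
   Context: Random walk with internal states (RWwIS). $E=\{1,\dots,s\}$ is a finite set, $d\ge1$, and $p_{y,j,k}\ge 0$ ($y\in\mathbb{Z}^d$, $j,k\in E$) satisfy $\sum_{y,k}p_{y,j,k}=1$ for each $j$. The RWwIS is the Markov chain $\xi_n=(\eta_n,\varepsilon_n)$ on $\mathbb{Z}^d\times E$ with $P(\xi_{n+1}=(x',k)\mid \xi_n=(x,j))=p_{x'-x,j,k}$; we start from $\eta_0=0$, the distribution of $\varepsilon_0$ being arbitrary. Put $A_y=(p_{y,j,k})_{j,k}$, $Q=\sum_y A_y$, $M_l=\sum_y y_lA_y$, $\Sigma_{l,m}=\sum_y y_ly_mA_y$, $\underline{1}=(1,\dots,1)^T\in\mathbb{R}^s$. Basic assumptions: (i) the Markov chain $(\varepsilon_n)$ on $E$, whose transition matrix is $Q$, is irreducible and aperiodic; $\mu$ is its unique stationary distribution. (ii) Trivial arithmetic: for $j\in E$ the subgroup of $\mathbb{Z}^d$ generated by all differences $y-y'$ such that for some $n\geq 1$ both $P(\xi_n=(y,j)\mid\xi_0=(0,j))>0$ and $P(\xi_n=(y',j)\mid\xi_0=(0,j))>0$ is $\mathbb{Z}^d$. (iii) Zero mean: $\langle\mu,M_l\underline{1}\rangle=0$ for all $l$. (iv)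 The second moments $\sum_y\|y\|^2A_y$ converge and the covariance matrix $\sigma=(\sigma_{l,m})_{1\le l,m\le d}$, $\sigma_{l,m}=\langle\mu,\Sigma_{l,m}\underline{1}\rangle-\langle\mu,M_l(Q-1)^{-1}M_m\underline{1}\rangle-\langle\mu,M_m(Q-1)^{-1}M_l\underline{1}\rangle$, is nonsingular (positive definite); here $(Q-1)^{-1}M_m\underline{1}$ is the unique vector $v$ with $\langle\mu,v\rangle=0$ and $Qv-v=M_m\underline{1}$. $L_d(n)=\#\{\eta_0,\dots,\eta_n\}$ is the number of distinct sites visited up to $n$ steps, and $E_d(n)$ is its expectation. *)

theory Defs
  imports
    "HOL-Probability.Probability"
    "HOL-Computational_Algebra.Group_Closure"
begin

text \<open>The lattice \<open>\<int>\<^sup>d\<close> is \<open>int ^ 'd\<close> with \<open>d = CARD('d)\<close>, and the set of internal states is the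
  finite type \<open>'e\<close>. The transition probabilities are \<open>p y j k\<close>: jump by \<open>y\<close> while the internal
  state changes from \<open>j\<close> to \<open>k\<close>.\<close>

definition jump_probabilities :: "(int ^ 'd \<Rightarrow> 'e::finite \<Rightarrow> 'e \<Rightarrow> real) \<Rightarrow> bool" where
  "jump_probabilities p \<longleftrightarrow>
     (\<forall>y j k. 0 \<le> p y j k) \<and> (\<forall>j. ((\<lambda>(y, k). p y j k) has_sum 1) UNIV)"

definition transition ::
    "(int ^ 'd \<Rightarrow> 'e::finite \<Rightarrow> 'e \<Rightarrow> real) \<Rightarrow> (int ^ 'd) \<times> 'e \<Rightarrow> (int ^ 'd) \<times> 'e \<Rightarrow> real" where
  "transition p a b = p (fst b - fst a) (snd a) (snd b)"

text \<open>\<open>P(\<xi>\<^sub>n = b | \<xi>\<^sub>0 = a)\<close>, defined through the transition probabilities because under the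
  (arbitrary) initial distribution of the process the event \<open>\<xi>\<^sub>0 = a\<close> may have probability 0.\<close>

primrec nstep_transition ::
    "(int ^ 'd \<Rightarrow> 'e::finite \<Rightarrow> 'e \<Rightarrow> real) \<Rightarrow> nat
      \<Rightarrow> (int ^ 'd) \<times> 'e \<Rightarrow> (int ^ 'd) \<times> 'e \<Rightarrow> real" where
  "nstep_transition p 0 a b = (if a = b then 1 else 0)"
| "nstep_transition p (Suc n) a b =
     (\<Sum>\<^sub>\<infinity>c. nstep_transition p n a c * transition p c b)"

definition rwwis ::
    "(int ^ 'd \<Rightarrow> 'e::finite \<Rightarrow> 'e \<Rightarrow> real) \<Rightarrow> 'w measure
      \<Rightarrow> (nat \<Rightarrow> 'w \<Rightarrow> (int ^ 'd) \<times> 'e) \<Rightarrow> bool" where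
  "rwwis p W \<xi> \<longleftrightarrow>
     jump_probabilities p \<and>
     prob_space W \<and>
     (\<forall>n. \<xi> n \<in> measurable W (count_space UNIV)) \<and>
     (AE w in W. fst (\<xi> 0 w) = 0) \<and>
     (\<forall>n x b. \<P>(w in W. \<forall>i\<le>n. \<xi> i w = x i) > 0 \<longrightarrow>
        \<P>(w in W. \<xi> (Suc n) w = b \<bar> \<forall>i\<le>n. \<xi> i w = x i) = transition p (x n) b)"

definition A_mat :: "(int ^ 'd \<Rightarrow> 'e::finite \<Rightarrow> 'e \<Rightarrow> real) \<Rightarrow> int ^ 'd \<Rightarrow> real ^ 'e ^ 'e" where
  "A_mat p y = (\<chi> j k. p y j k)"

definition Q_mat :: "(int ^ 'd \<Rightarrow> 'e::finite \<Rightarrow> 'e \<Rightarrow> real) \<Rightarrow> real ^ 'e ^ 'e" where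
  "Q_mat p = (\<Sum>\<^sub>\<infinity>y. A_mat p y)"

definition M_mat :: "(int ^ 'd \<Rightarrow> 'e::finite \<Rightarrow> 'e \<Rightarrow> real) \<Rightarrow> 'd \<Rightarrow> real ^ 'e ^ 'e" where
  "M_mat p l = (\<Sum>\<^sub>\<infinity>y. real_of_int (y $ l) *\<^sub>R A_mat p y)"

definition Sigma_mat :: "(int ^ 'd \<Rightarrow> 'e::finite \<Rightarrow> 'e \<Rightarrow> real) \<Rightarrow> 'd \<Rightarrow> 'd \<Rightarrow> real ^ 'e ^ 'e" where
  "Sigma_mat p l m = (\<Sum>\<^sub>\<infinity>y. real_of_int (y $ l * y $ m) *\<^sub>R A_mat p y)"

text \<open>Powers with respect to the matrix product; \<open>^\<close> on vectors is componentwise.\<close>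

definition mat_power :: "real ^ 'e ^ 'e \<Rightarrow> nat \<Rightarrow> real ^ 'e ^ 'e" where
  "mat_power B n = (((**) B) ^^ n) (mat 1)"

definition irreducible_mat :: "real ^ 'e ^ 'e \<Rightarrow> bool" where
  "irreducible_mat B \<longleftrightarrow> (\<forall>j k. \<exists>n. mat_power B n $ j $ k > 0)"

definition aperiodic_mat :: "real ^ 'e ^ 'e \<Rightarrow> bool" where
  "aperiodic_mat B \<longleftrightarrow> (\<forall>j. Gcd {n::nat. n \<ge> 1 \<and> mat_power B n $ j $ j > 0} = 1)"

definition stationary_distribution :: "real ^ 'e ^ 'e \<Rightarrow> real ^ 'e \<Rightarrow> bool" where
  "stationary_distribution B \<mu> \<longleftrightarrow>
     (\<forall>j. 0 \<le> \<mu> $ j) \<and> (\<Sum>j\<in>UNIV. \<mu> $ j) = 1 \<and> \<mu> v* B = \<mu>"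

definition trivial_arithmetic :: "(int ^ 'd \<Rightarrow> 'e::finite \<Rightarrow> 'e \<Rightarrow> real) \<Rightarrow> bool" where
  "trivial_arithmetic p \<longleftrightarrow>
     (\<forall>j. group_closure {y - y' | y y'. \<exists>n\<ge>1.
          nstep_transition p n (0, j) (y, j) > 0 \<and>
          nstep_transition p n (0, j) (y', j) > 0} = UNIV)"

definition zero_mean :: "(int ^ 'd \<Rightarrow> 'e::finite \<Rightarrow> 'e \<Rightarrow> real) \<Rightarrow> real ^ 'e \<Rightarrow> bool" where
  "zero_mean p \<mu> \<longleftrightarrow> (\<forall>l. \<mu> \<bullet> (M_mat p l *v 1) = 0)"

definition finite_second_moments :: "(int ^ 'd \<Rightarrow> 'e::finite \<Rightarrow> 'e \<Rightarrow> real) \<Rightarrow> bool" where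
  "finite_second_moments p \<longleftrightarrow>
     (\<lambda>y. (norm (\<chi> l. real_of_int (y $ l)))\<^sup>2 *\<^sub>R A_mat p y) summable_on UNIV"

text \<open>\<open>(Q - 1)\<^sup>-\<^sup>1 u\<close> for a vector \<open>u\<close> with \<open>\<langle>\<mu>, u\<rangle> = 0\<close>.\<close>

definition Q_minus_1_inv ::
    "(int ^ 'd \<Rightarrow> 'e::finite \<Rightarrow> 'e \<Rightarrow> real) \<Rightarrow> real ^ 'e \<Rightarrow> real ^ 'e \<Rightarrow> real ^ 'e" where
  "Q_minus_1_inv p \<mu> u = (THE v. \<mu> \<bullet> v = 0 \<and> Q_mat p *v v - v = u)"

definition covariance_mat ::
    "(int ^ 'd \<Rightarrow> 'e::finite \<Rightarrow> 'e \<Rightarrow> real) \<Rightarrow> real ^ 'e \<Rightarrow> real ^ 'd ^ 'd" where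
  "covariance_mat p \<mu> = (\<chi> l m.
     \<mu> \<bullet> (Sigma_mat p l m *v 1)
     - \<mu> \<bullet> (M_mat p l *v Q_minus_1_inv p \<mu> (M_mat p m *v 1))
     - \<mu> \<bullet> (M_mat p m *v Q_minus_1_inv p \<mu> (M_mat p l *v 1)))"

definition sites_visited :: "(nat \<Rightarrow> 'w \<Rightarrow> (int ^ 'd) \<times> 'e) \<Rightarrow> nat \<Rightarrow> 'w \<Rightarrow> nat" where
  "sites_visited \<xi> n w = card ((\<lambda>i. fst (\<xi> i w)) ` {..n})"

definition expected_sites ::
    "'w measure \<Rightarrow> (nat \<Rightarrow> 'w \<Rightarrow> (int ^ 'd) \<times> 'e) \<Rightarrow> nat \<Rightarrow> real" where
  "expected_sites W \<xi> n = prob_space.expectation W (\<lambda>w. real (sites_visited \<xi> n w))"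

end

theory Submission
  imports Defs "HOL-Real_Asymp.Real_Asymp"
begin

text \<open>
  Count every visited site at its last visit: the number \<open>L\<^sub>n\<close> of sites visited up to time \<open>n\<close> is the
  number of times \<open>k \<le> n\<close> after which the walk does not come back up to time \<open>n\<close> to the site that it
  occupies at time \<open>k\<close>. The proof rests on transience, in the strong form that the expected number
  of visits to a site is bounded uniformly in the site and in the initial internal state
  (\<open>rwwis_transient\<close>). It is used twice.

  It makes the expectation of \<open>L\<^sub>n\<close> grow linearly (\<open>expected_sites_ge\<close>): the number of pairs of times
  at which the walk occupies the same site has expectation of order \<open>n\<close>, and a sequence of length
  \<open>n\<close> with so few coincidences has to take a number of values of order \<open>n\<close>.

  It also makes \<open>L\<^sub>n\<close> nearly local. Late returns are rare uniformly in the state, so forbidding only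
  the returns within the next \<open>m\<close> steps changes \<open>L\<^sub>n\<close> by a small proportion of \<open>n\<close> in the mean
  (\<open>card_image_approx\<close>, \<open>uniform_return_tail\<close>). The indicator of no return within \<open>m\<close> steps after time
  \<open>l\<close> has, given the past up to \<open>l\<close>, an expectation \<open>h(\<epsilon>\<^sub>l)\<close> that depends on the internal state alone.
  Indicators minus conditional expectations are uncorrelated as soon as their times differ by \<open>m\<close>,
  and the Poisson equation \<open>h = c + v - Q v\<close> (\<open>poisson_equation\<close>) turns the sum of the \<open>h(\<epsilon>\<^sub>l) - c\<close> into
  a martingale plus a bounded term. So the local count deviates from a multiple of \<open>n\<close> only by
  order \<open>sqrt n\<close> in the mean (\<open>no_return_deviation\<close>). Altogether the mean of \<open>\<bar>L\<^sub>n - E L\<^sub>n\<bar>\<close> is \<open>o(n)\<close>, and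
  Markov's inequality gives the weak law (\<open>weak_law_sites\<close>).

  Transience holds because the walk spreads in three independent directions. As the differences of
  possible displacements between returns to one internal state generate the lattice, three of them,
  \<open>D\<^sub>1\<close>, \<open>D\<^sub>2\<close>, \<open>D\<^sub>3\<close>, are linearly independent (\<open>three_independent_directions\<close>). By irreducibility the
  walk makes, from any internal state and with at least a fixed positive probability within a bounded
  time, three independent fair choices whether to add \<open>D\<^sub>i\<close> to its displacement. After \<open>N\<close> such
  rounds the three numbers of additions are independent binomial variables, so that no site has
  probability above a constant times \<open>N powr (- 3 / 2)\<close> (\<open>funpow_avg3_le\<close>). These bounds are summable over \<open>N\<close>, and the
  expected number of steps between two rounds is bounded; this bounds the expected number of visits
  (\<open>visits_bounded\<close>).
\<close>

section \<open>Expectations with respect to discrete distributions\<close>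

lemma integral_pmf_bind:
  fixes f :: "'b \<Rightarrow> real"
  assumes "\<And>x. \<bar>f x\<bar> \<le> B"
  shows "measure_pmf.expectation (bind_pmf N g) f = measure_pmf.expectation N (\<lambda>x. measure_pmf.expectation (g x) f)"
  unfolding measure_pmf_bind
  by (subst integral_bind[where K="count_space UNIV" and B'=1 and B=B])
     (use assms in \<open>auto simp: measure_pmf.emeasure_space_1 space_subprob_algebra measure_pmf.subprob_space_axioms\<close>)

lemma integrable_pmf_bounded:
  fixes f :: "'b \<Rightarrow> real"
  shows "(\<And>x. \<bar>f x\<bar> \<le> B) \<Longrightarrow> integrable (measure_pmf N) f"
  by (rule measure_pmf.integrable_const_bound[where B=B]) auto

lemma abs_expectation_pmf_le:
  fixes f :: "'b \<Rightarrow> real"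
  assumes "\<And>x. \<bar>f x\<bar> \<le> B"
  shows "\<bar>measure_pmf.expectation P f\<bar> \<le> B"
proof -
  have "\<bar>measure_pmf.expectation P f\<bar> \<le> measure_pmf.expectation P (\<lambda>x. \<bar>f x\<bar>)" by (rule integral_abs_bound)
  also have "\<dots> \<le> measure_pmf.expectation P (\<lambda>_. B)"
    by (intro integral_mono integrable_pmf_bounded[where B=B]) (use assms in \<open>auto intro: order_trans[OF abs_ge_zero]\<close>)
  finally show ?thesis by simp
qed

section \<open>Spreading by independent two-point choices\<close>

text \<open>The square of the left-hand side times \<open>2 m + 1\<close> decreases in \<open>m\<close>: its successive quotients are
  \<open>(2 m + 1) (2 m + 3) / (2 m + 2)\<^sup>2\<close>.\<close>

lemma central_binomial_sqrt_bound: "real (2*m choose m) / 4^m \<le> 1 / sqrt (real (2*m+1))"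
proof -
  have "(real (2*m choose m) / 4^m)\<^sup>2 * real (2*m+1) \<le> 1"
  proof (induction m)
    case (Suc m)
    have "Suc m * (2 * Suc m choose Suc m) = Suc m * (2 * (2*m+1 choose m))"
      using Suc_times_binomial[of m "2*m+1"] by simp
    then have "2 * Suc m choose Suc m = 2 * (2*m+1 choose m)" by (simp only: mult_cancel1) simp
    moreover have "Suc m * (2*m+1 choose m) = (2*m+1) * (2*m choose m)"
      using binomial_absorb_comp[of "2*m+1" m] by simp
    ultimately have "Suc m * (2 * Suc m choose Suc m) = 2 * (2*m+1) * (2*m choose m)"
      by (metis mult.assoc mult.left_commute)
    then have e: "real (Suc m) * real (2 * Suc m choose Suc m) = 2 * real (2*m+1) * real (2*m choose m)"
      by (metis of_nat_mult of_nat_numeral)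
    have gen: "A / (4 * q) = (y / (2 * x)) * (C / q)" if "x * A = 2 * y * C" "x \<noteq> 0" "q \<noteq> 0" for A C x y q :: real
      using that by (simp add: field_simps)
    have e': "real (2 * Suc m choose Suc m) / 4^Suc m = (real (2*m+1) / real (2*m+2)) * (real (2*m choose m) / 4^m)"
      using gen[OF e, of "4^m"] by simp
    have "(real (2 * Suc m choose Suc m) / 4^Suc m)\<^sup>2 * real (2 * Suc m+1)
        = ((real (2*m choose m) / 4^m)\<^sup>2 * real (2*m+1)) * (real (2*m+1) * real (2*m+3) / (real (2*m+2))\<^sup>2)"
      unfolding e' power_mult_distrib by (simp add: power2_eq_square ac_simps)
    also have "\<dots> \<le> 1 * 1"
    proof (intro mult_mono Suc)
      have "real (2*m+1) * real (2*m+3) \<le> (real (2*m+2))\<^sup>2"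
        by (simp add: power2_eq_square algebra_simps)
      then show "real (2*m+1) * real (2*m+3) / (real (2*m+2))\<^sup>2 \<le> 1"
        by (intro divide_le_eq_1[THEN iffD2] disjI1 conjI) auto
    qed auto
    finally show ?case by simp
  qed simp
  then have "(real (2*m choose m) / 4^m)\<^sup>2 \<le> (1 / sqrt (real (2*m+1)))\<^sup>2"
    by (simp add: field_simps power_divide)
  then show ?thesis by (rule power2_le_imp_le) simp
qed

lemma binomial_weight_le: "real (N choose k) / 2^N \<le> 1 / sqrt (real (max 1 N))"
proof -
  have even: "real (2*m choose k) / 4^m \<le> 1 / sqrt (real (2*m+1))" for m k
    using central_binomial_sqrt_bound[of m] binomial_maximum'[of m k]
    by (smt (verit) divide_right_mono of_nat_le_iff zero_le_power)
  show ?thesis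
  proof (cases "even N")
    case True
    then obtain m where N: "N = 2*m" by blast
    have "1 / sqrt (real (2*m+1)) \<le> 1 / sqrt (real (max 1 N))"
      by (intro divide_left_mono real_sqrt_le_mono) (auto simp: N max_def)
    then show ?thesis using even[of m k] by (simp add: N power_mult)
  next
    case False
    then obtain m where N: "N = 2*m+1" using oddE by blast
    show ?thesis
    proof (cases k)
      case 0
      have "real (2*m choose 0) / 4^m \<le> 1 / sqrt (real (2*m+1))" by (rule even)
      moreover have "1 / (2 * 4^m) \<le> (1 / 4^m::real)" by (simp add: field_simps)
      ultimately show ?thesis by (simp add: 0 N power_mult)
    next
      case (Suc l)
      have "real (N choose k) / 2^N = (real (2*m choose l) / 4^m + real (2*m choose k) / 4^m) / 2"
        by (simp add: N Suc power_mult add_divide_distrib)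
      also have "\<dots> \<le> 1 / sqrt (real (2*m+1))"
        using add_mono[OF even[of m l] even[of m k]] by (subst divide_le_eq_numeral1(1)) simp
      finally show ?thesis by (simp add: N)
    qed
  qed
qed

text \<open>This is where the number of directions matters: with two independent directions instead of three
  the exponent would be \<open>1\<close> and the series would diverge.\<close>

lemma summable_return_bound: "summable (\<lambda>N::nat. (1 / sqrt (real (max 1 N)))^3)"
proof -
  have "summable (\<lambda>N. real N powr (-3/2))" by (subst summable_real_powr_iff) auto
  moreover have "eventually (\<lambda>N. (1 / sqrt (real (max 1 N)))^3 = real N powr (-3/2)) sequentially"
    using eventually_ge_at_top[of 1]
  proof eventually_elim
    case (elim N)
    then have "(1 / sqrt (real (max 1 N)))^3 = (real N powr (-1/2)) powr 3"
      by (subst powr_numeral) (auto simp: powr_half_sqrt[symmetric] powr_minus_divide max_def)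
    then show ?case by (simp add: powr_powr)
  qed
  ultimately show ?thesis by (subst summable_cong) auto
qed

text \<open>Convolution with the uniform distribution on \<open>{0, D}\<close>. Its iterates describe a displacement that
  is made more and more random by independent fair choices.\<close>

definition avg :: "int ^ 'd \<Rightarrow> (int ^ 'd \<Rightarrow> real) \<Rightarrow> int ^ 'd \<Rightarrow> real" where
  "avg D f x = (f x + f (x - D)) / 2"

lemma funpow_avg: "(avg D ^^ N) f x = (\<Sum>k\<le>N. real (N choose k) / 2^N * f (x - int k *s D))"
proof (induction N arbitrary: x)
  case 0 then show ?case by (simp add: vector_scalar_mult_def zero_vec_def[symmetric])
next
  case (Suc N)
  let ?g = "\<lambda>k. f (x - int k *s D)"
  have s: "x - D - int k *s D = x - int (Suc k) *s D" for k
    by (simp add: vec_eq_iff algebra_simps)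
  have w: "(\<Sum>k\<le>M. real (M choose k) / 2^M * h k) = (\<Sum>k\<le>M. real (M choose k) * h k) / 2^M" for h and M
    by (simp add: sum_divide_distrib)
  have "(avg D ^^ Suc N) f x = ((\<Sum>k\<le>N. real (N choose k) * ?g k) + (\<Sum>k\<le>N. real (N choose k) * ?g (Suc k))) / 2^Suc N"
    unfolding funpow.simps o_apply avg_def Suc.IH s w by (simp add: add_divide_distrib)
  also have "(\<Sum>k\<le>N. real (N choose k) * ?g k) = (\<Sum>k\<le>Suc N. real (N choose k) * ?g k)" by simp
  also have "\<dots> = ?g 0 + (\<Sum>k\<le>N. real (N choose Suc k) * ?g (Suc k))"
    by (subst sum.atMost_Suc_shift) simp
  also have "?g 0 + (\<Sum>k\<le>N. real (N choose Suc k) * ?g (Suc k)) + (\<Sum>k\<le>N. real (N choose k) * ?g (Suc k))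
     = ?g 0 + (\<Sum>k\<le>N. real (Suc N choose Suc k) * ?g (Suc k))"
    by (simp add: sum.distrib[symmetric] algebra_simps)
  also have "\<dots> = (\<Sum>k\<le>Suc N. real (Suc N choose k) * ?g k)"
    by (subst sum.atMost_Suc_shift) simp
  finally show ?case by (simp only: w)
qed

lemma avg_commute: "avg D (avg E f) = avg E (avg D f)"
  by (rule ext) (simp add: avg_def field_simps algebra_simps)

lemma avg_funpow_commute: "(avg D ^^ N) (avg E f) = avg E ((avg D ^^ N) f)"
  by (induction N) (auto simp: avg_commute)

definition avg3 where "avg3 D1 D2 D3 f = avg D1 (avg D2 (avg D3 f))"

lemma funpow_avg3: "(avg3 D1 D2 D3 ^^ N) f = (avg D1 ^^ N) ((avg D2 ^^ N) ((avg D3 ^^ N) f))"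
proof (induction N)
  case (Suc N)
  have "(avg3 D1 D2 D3 ^^ Suc N) f = avg3 D1 D2 D3 ((avg3 D1 D2 D3 ^^ N) f)" by simp
  also have "\<dots> = avg D1 (avg D2 (avg D3 ((avg D1 ^^ N) ((avg D2 ^^ N) ((avg D3 ^^ N) f)))))"
    unfolding Suc.IH by (simp add: avg3_def)
  finally show ?case by (simp add: avg_funpow_commute)
qed simp

text \<open>For a distribution of total mass at most \<open>S\<close>: each of the three binomial weights is at most
  \<open>1 / sqrt (max 1 N)\<close>, and by linear independence the sites at which \<open>g\<close> is evaluated are distinct, so
  that the values of \<open>g\<close> add up to at most \<open>S\<close>.\<close>

lemma funpow_avg3_le:
  assumes inj: "inj (\<lambda>(a::int,b,c). a *s D1 + b *s D2 + c *s D3)"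
    and nonneg: "\<And>x. 0 \<le> g x" and mass: "\<And>X. finite X \<Longrightarrow> sum g X \<le> S"
  shows "(avg3 D1 D2 D3 ^^ N) g x \<le> S * (1 / sqrt (real (max 1 N)))^3"
proof -
  let ?w = "\<lambda>k. real (N choose k) / 2^N" and ?B = "1 / sqrt (real (max 1 N))"
  let ?pos = "\<lambda>(a::nat,b::nat,c::nat). x - int a *s D1 - int b *s D2 - int c *s D3"
  have B: "0 \<le> ?B" by simp
  have w: "0 \<le> ?w k" "?w k \<le> ?B" for k using binomial_weight_le[of N k] by auto
  have injp: "inj_on ?pos ({..N} \<times> {..N} \<times> {..N})"
  proof (rule inj_onI)
    fix u v assume e: "?pos u = ?pos v"
    obtain a b c a' b' c' where uv: "u = (a, b, c)" "v = (a', b', c')" by (metis prod_cases3)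
    from e have "int a *s D1 + int b *s D2 + int c *s D3 = int a' *s D1 + int b' *s D2 + int c' *s D3"
      by (simp add: uv algebra_simps)
    then show "u = v"
      using injD[OF inj, of "(int a, int b, int c)" "(int a', int b', int c')"] by (simp add: uv)
  qed
  have cube: "(\<Sum>a\<le>N. B * (\<Sum>b\<le>N. B * (\<Sum>c\<le>N. B * h a b c))) = B^3 * (\<Sum>a\<le>N. \<Sum>b\<le>N. \<Sum>c\<le>N. h a b c)"
    for B :: real and h by (simp add: sum_distrib_left power3_eq_cube mult.assoc)
  have "(avg3 D1 D2 D3 ^^ N) g x = (\<Sum>a\<le>N. ?w a * (\<Sum>b\<le>N. ?w b * (\<Sum>c\<le>N. ?w c * g (?pos (a,b,c)))))"
    unfolding funpow_avg3 funpow_avg by simp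
  also have "\<dots> \<le> (\<Sum>a\<le>N. ?B * (\<Sum>b\<le>N. ?B * (\<Sum>c\<le>N. ?B * g (?pos (a,b,c)))))"
    by (intro sum_mono mult_mono w sum_nonneg mult_nonneg_nonneg nonneg B) auto
  also have "\<dots> = ?B^3 * (\<Sum>a\<le>N. \<Sum>b\<le>N. \<Sum>c\<le>N. g (?pos (a,b,c)))"
    by (rule cube)
  also have "(\<Sum>a\<le>N. \<Sum>b\<le>N. \<Sum>c\<le>N. g (?pos (a,b,c))) = sum g (?pos ` ({..N} \<times> {..N} \<times> {..N}))"
    by (subst sum.reindex[OF injp]) (simp add: sum.cartesian_product case_prod_beta)
  also have "?B^3 * sum g (?pos ` ({..N} \<times> {..N} \<times> {..N})) \<le> ?B^3 * S"
    by (intro mult_left_mono mass) auto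
  finally show ?thesis by (simp add: mult.commute)
qed

lemma avg_mono: "(\<And>x. f x \<le> g x) \<Longrightarrow> avg D f x \<le> avg D g x"
  by (simp add: avg_def add_mono)

lemma avg3_funpow_mono: "(\<And>x. f x \<le> g x) \<Longrightarrow> (avg3 D1 D2 D3 ^^ N) f x \<le> (avg3 D1 D2 D3 ^^ N) g x"
  by (induction N arbitrary: x) (auto simp: avg3_def intro!: avg_mono)

lemma avg_const: "avg D (\<lambda>_. c) = (\<lambda>_. c)"
  by (simp add: avg_def fun_eq_iff)

lemma avg3_funpow_const: "(avg3 D1 D2 D3 ^^ N) (\<lambda>_. c) = (\<lambda>_. c)"
  by (induction N) (auto simp: avg3_def avg_const)

lemma avg_diff: "avg D (\<lambda>x. f x - g x) = (\<lambda>x. avg D f x - avg D g x)"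
  and avg_add: "avg D (\<lambda>x. f x + g x) = (\<lambda>x. avg D f x + avg D g x)"
  by (simp_all add: avg_def fun_eq_iff field_simps)

lemma avg3_funpow_add: "(avg3 D1 D2 D3 ^^ N) (\<lambda>x. f x + g x) = (\<lambda>x. (avg3 D1 D2 D3 ^^ N) f x + (avg3 D1 D2 D3 ^^ N) g x)"
  by (induction N) (auto simp: avg3_def avg_add)

lemma foldr_avg_mono: "(\<And>x. f x \<le> g x) \<Longrightarrow> foldr avg Ds f x \<le> foldr avg Ds g x"
  by (induction Ds arbitrary: x) (auto intro!: avg_mono)

lemma foldr_avg_affine: "foldr avg Ds (\<lambda>x. c * f (x - w)) = (\<lambda>x. c * foldr avg Ds f (x - w))"
  by (induction Ds) (auto simp: avg_def fun_eq_iff algebra_simps add_divide_distrib)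

text \<open>Two convolutions commute: averaging the target \<open>x\<close> over the choices, and averaging over the position
  and internal state \<open>b\<close> that the walk reaches.\<close>

lemma avg_integral:
  assumes "\<And>k x. \<bar>F k x\<bar> \<le> B"
  shows "avg D (\<lambda>x. measure_pmf.expectation P (\<lambda>b. F (snd b) (x - fst b)))
       = (\<lambda>x. measure_pmf.expectation P (\<lambda>b. avg D (F (snd b)) (x - fst b)))"
proof -
  have i: "integrable P (\<lambda>b. F (snd b) (y - fst b))" for y
    by (rule integrable_pmf_bounded) (rule assms)
  have *: "avg D (F (snd b)) (x - fst b) = (F (snd b) (x - fst b) + F (snd b) (x - D - fst b)) / 2" for b x
    by (simp add: avg_def diff_diff_eq add.commute)
  then show ?thesis by (intro ext, subst avg_def) (simp add: * i del: divide_eq_eq_numeral1 eq_divide_eq_numeral1)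
qed

lemma avg_abs_le: "(\<And>x. \<bar>f x\<bar> \<le> B) \<Longrightarrow> \<bar>avg D f x\<bar> \<le> B"
proof -
  assume "\<And>x. \<bar>f x\<bar> \<le> B"
  from this[of x] this[of "x - D"] show ?thesis by (simp add: avg_def abs_le_iff)
qed

lemma avg3_funpow_abs_le: "(\<And>x. \<bar>f x\<bar> \<le> B) \<Longrightarrow> \<bar>(avg3 D1 D2 D3 ^^ N) f x\<bar> \<le> B"
  by (induction N arbitrary: x) (auto simp: avg3_def intro!: avg_abs_le)

lemma avg3_funpow_integral:
  assumes "\<And>k x. \<bar>F k x\<bar> \<le> B"
  shows "(avg3 D1 D2 D3 ^^ N) (\<lambda>x. measure_pmf.expectation P (\<lambda>b. F (snd b) (x - fst b))) x
       = measure_pmf.expectation P (\<lambda>b. (avg3 D1 D2 D3 ^^ N) (F (snd b)) (x - fst b))"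
proof (induction N arbitrary: x)
  case (Suc N)
  let ?F = "\<lambda>k. (avg3 D1 D2 D3 ^^ N) (F k)"
  have b: "\<bar>?F k x\<bar> \<le> B" for k x by (intro avg3_funpow_abs_le assms)
  have b3: "\<bar>avg D3 (?F k) x\<bar> \<le> B" for k x by (intro avg_abs_le b)
  have b2: "\<bar>avg D2 (avg D3 (?F k)) x\<bar> \<le> B" for k x by (intro avg_abs_le b3)
  have step: "(avg3 D1 D2 D3 ^^ Suc N) f = avg D1 (avg D2 (avg D3 ((avg3 D1 D2 D3 ^^ N) f)))" for f
    by (simp add: avg3_def)
  have "(avg3 D1 D2 D3 ^^ N) (\<lambda>x. measure_pmf.expectation P (\<lambda>b. F (snd b) (x - fst b)))
    = (\<lambda>x. measure_pmf.expectation P (\<lambda>b. ?F (snd b) (x - fst b)))"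
    using Suc by (simp add: fun_eq_iff)
  then show ?case
    by (simp add: step del: funpow.simps add: avg_integral[where F="?F", OF b] avg_integral[where F="\<lambda>k. avg D3 (?F k)", OF b3] avg_integral[where F="\<lambda>k. avg D2 (avg D3 (?F k))", OF b2])
qed simp

section \<open>Bounded Green function of a minorized walk\<close>

text \<open>The kernel of a random walk with internal states: jumps depend on the internal state but not on
  the site.\<close>

locale walk_kernel =
  fixes K :: "(int ^ 'd) \<times> 'e::finite \<Rightarrow> ((int ^ 'd) \<times> 'e) pmf"
  assumes shift: "K (u + x, j) = map_pmf (apfst ((+) u)) (K (x, j))"
begin

primrec walk :: "nat \<Rightarrow> (int ^ 'd) \<times> 'e \<Rightarrow> ((int ^ 'd) \<times> 'e) pmf" where
  "walk 0 a = return_pmf a"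
| "walk (Suc n) a = bind_pmf (walk n a) K"

lemma walk_add: "walk (m + n) a = bind_pmf (walk m a) (walk n)"
  by (induction n) (auto simp: bind_return_pmf' bind_assoc_pmf)

lemma walk_shift: "walk n (u + x, j) = map_pmf (apfst ((+) u)) (walk n (x, j))"
proof (induction n)
  case (Suc n)
  have "K (apfst ((+) u) b) = map_pmf (apfst ((+) u)) (K b)" for b
    using shift[of u "fst b" "snd b"] by (simp add: apfst_def map_prod_def case_prod_beta)
  then show ?case by (simp add: Suc bind_map_pmf map_bind_pmf)
qed simp

lemma walk_from: "walk n b = map_pmf (apfst ((+) (fst b))) (walk n (0, snd b))"
  using walk_shift[of n "fst b" 0 "snd b"] by simp

definition hit :: "nat \<Rightarrow> 'e \<Rightarrow> int ^ 'd \<Rightarrow> real" where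
  "hit n j x = measure_pmf.prob (walk n (0, j)) {b. fst b = x}"

lemma hit_bounds: "0 \<le> hit n j x" "hit n j x \<le> 1" "\<bar>hit n j x\<bar> \<le> 1"
  by (auto simp: hit_def)

lemma hit_from: "measure_pmf.prob (walk n b) {b. fst b = x} = hit n (snd b) (x - fst b)"
  by (subst walk_from) (auto simp: hit_def vimage_def eq_diff_eq add.commute)

lemma hit_add: "hit (m + n) j x = measure_pmf.expectation (walk m (0, j)) (\<lambda>b. hit n (snd b) (x - fst b))"
proof -
  have "hit (m + n) j x = measure_pmf.expectation (walk (m+n) (0, j)) (indicator {b. fst b = x})"
    by (simp add: hit_def)
  also have "\<dots> = measure_pmf.expectation (walk m (0, j)) (\<lambda>b. measure_pmf.expectation (walk n b) (indicator {b. fst b = x}))"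
    unfolding walk_add by (rule integral_pmf_bind[where B=1]) (auto simp: indicator_def)
  finally show ?thesis by (simp add: hit_from)
qed

lemma sum_hit_le: "finite X \<Longrightarrow> (\<Sum>x\<in>X. hit n j x) \<le> 1"
proof -
  assume X: "finite X"
  have "(\<Sum>x\<in>X. hit n j x) = measure_pmf.prob (walk n (0, j)) (\<Union>x\<in>X. {b. fst b = x})"
    unfolding hit_def by (rule measure_pmf.finite_measure_finite_Union[symmetric]) (auto simp: X disjoint_family_on_def)
  then show ?thesis by simp
qed

text \<open>The Green function truncated at time \<open>M\<close>.\<close>

definition visits :: "nat \<Rightarrow> 'e \<Rightarrow> int ^ 'd \<Rightarrow> real" where
  "visits M j x = (\<Sum>n<M. hit n j x)"

text \<open>The mean of \<open>\<phi>\<close> at the point that is left to go to reach \<open>x\<close>, restricted to the event that the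
  internal state after \<open>n\<close> steps is \<open>j\<close>. The sign of the displacement is chosen so that this operator,
  like \<open>avg\<close>, is a convolution.\<close>

definition restricted_mean :: "nat \<Rightarrow> 'e \<Rightarrow> 'e \<Rightarrow> (int ^ 'd \<Rightarrow> real) \<Rightarrow> int ^ 'd \<Rightarrow> real" where
  "restricted_mean n i j \<phi> x = measure_pmf.expectation (walk n (0, i)) (\<lambda>b. if snd b = j then \<phi> (x - fst b) else 0)"

lemma restricted_mean_bounds:
  assumes "\<And>x. 0 \<le> \<phi> x" "\<And>x. \<phi> x \<le> B"
  shows "0 \<le> restricted_mean n i j \<phi> x" "restricted_mean n i j \<phi> x \<le> B"
proof -
  have "0 \<le> B" using order_trans[OF assms(1) assms(2)] by blast
  have i: "integrable (walk n (0,i)) (\<lambda>b. if snd b = j then \<phi> (x - fst b) else 0)"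
    by (rule integrable_pmf_bounded[where B=B]) (use assms \<open>0 \<le> B\<close> in auto)
  show "0 \<le> restricted_mean n i j \<phi> x" unfolding restricted_mean_def by (rule Bochner_Integration.integral_nonneg) (use assms in auto)
  have "restricted_mean n i j \<phi> x \<le> measure_pmf.expectation (walk n (0,i)) (\<lambda>_. B)"
    unfolding restricted_mean_def by (rule integral_mono[OF i]) (use assms \<open>0 \<le> B\<close> in auto)
  then show "restricted_mean n i j \<phi> x \<le> B" by simp
qed

lemma restricted_mean_ge_point:
  assumes "\<And>x. 0 \<le> \<phi> x" "\<And>x. \<phi> x \<le> B"
  shows "pmf (walk n (0, i)) (w, j) * \<phi> (x - w) \<le> restricted_mean n i j \<phi> x"
proof -
  have "0 \<le> B" using order_trans[OF assms(1) assms(2)] by blast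
  have "pmf (walk n (0, i)) (w, j) * \<phi> (x - w) = measure_pmf.expectation (walk n (0,i)) (\<lambda>b. indicator {(w,j)} b * \<phi> (x - w))"
    by (simp add: measure_pmf_single)
  also have "\<dots> \<le> restricted_mean n i j \<phi> x" unfolding restricted_mean_def
    by (intro integral_mono integrable_pmf_bounded[where B=B]) (use assms \<open>0 \<le> B\<close> in \<open>auto simp: indicator_def\<close>)
  finally show ?thesis .
qed

text \<open>Passing through internal state \<open>j\<close> at the intermediate time is only one of the possibilities,
  hence an inequality.\<close>

lemma restricted_mean_add_ge:
  assumes "\<And>x. 0 \<le> \<phi> x" "\<And>x. \<phi> x \<le> B"
  shows "restricted_mean m i j (restricted_mean n j j \<phi>) x \<le> restricted_mean (m + n) i j \<phi> x"
proof -
  have B: "0 \<le> B" using order_trans[OF assms(1) assms(2)] by blast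
  have *: "measure_pmf.expectation (walk n b) (\<lambda>b. if snd b = j then \<phi> (x - fst b) else 0) = restricted_mean n (snd b) j \<phi> (x - fst b)" for b
    by (subst walk_from) (simp add: restricted_mean_def diff_diff_eq cong: if_cong)
  have "restricted_mean m i j (restricted_mean n j j \<phi>) x \<le> measure_pmf.expectation (walk m (0,i)) (\<lambda>b. restricted_mean n (snd b) j \<phi> (x - fst b))"
    unfolding restricted_mean_def[of m]
    by (intro integral_mono integrable_pmf_bounded[where B=B]) (use restricted_mean_bounds[of \<phi> B, OF assms] B in auto)
  also have "\<dots> = restricted_mean (m+n) i j \<phi> x"
    unfolding restricted_mean_def[of "m+n"] walk_add *[symmetric]
    by (rule integral_pmf_bind[where B=B, symmetric]) (use assms B in auto)
  finally show ?thesis .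
qed

text \<open>A minorization condition in the sense of Doeblin: the part of the distribution after \<open>n\<close> steps
  that ends in internal state \<open>j\<close> dominates \<open>c\<close> times the distribution of \<open>w\<close> plus an independent
  uniform choice from each \<open>{0, D}\<close>, \<open>D \<in> Ds\<close>. It is stated through test functions because it is
  applied to Green functions.\<close>

definition minorizes :: "nat \<Rightarrow> 'e \<Rightarrow> 'e \<Rightarrow> int ^ 'd \<Rightarrow> real \<Rightarrow> (int ^ 'd) list \<Rightarrow> bool" where
  "minorizes n i j w c Ds \<longleftrightarrow> (\<forall>\<phi> B x. (\<forall>x. 0 \<le> \<phi> x \<and> \<phi> x \<le> B) \<longrightarrow> c * foldr avg Ds \<phi> (x - w) \<le> restricted_mean n i j \<phi> x)"

lemma minorizesD:
  "minorizes n i j w c Ds \<Longrightarrow> (\<And>x. 0 \<le> \<phi> x) \<Longrightarrow> (\<And>x. \<phi> x \<le> B) \<Longrightarrow> c * foldr avg Ds \<phi> (x - w) \<le> restricted_mean n i j \<phi> x"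
  unfolding minorizes_def by blast

lemma minorizes_trans:
  assumes "minorizes m i j w c Ds" "minorizes n j j v c' Es" "0 \<le> c"
  shows "minorizes (m + n) i j (w + v) (c * c') (Ds @ Es)"
  unfolding minorizes_def
proof (intro allI impI)
  fix \<phi> :: "int ^ 'd \<Rightarrow> real" and B x
  assume b: "\<forall>x. 0 \<le> \<phi> x \<and> \<phi> x \<le> B"
  then have b': "\<And>x. 0 \<le> \<phi> x" "\<And>x. \<phi> x \<le> B" by auto
  have "c * c' * foldr avg (Ds @ Es) \<phi> (x - (w + v)) = c * foldr avg Ds (\<lambda>x. c' * foldr avg Es \<phi> (x - v)) (x - w)"
    by (subst foldr_avg_affine) (simp add: algebra_simps)
  also have "\<dots> \<le> c * foldr avg Ds (restricted_mean n j j \<phi>) (x - w)"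
    by (intro mult_left_mono foldr_avg_mono) (use assms(3) minorizesD[of n j j v c' Es \<phi> B, OF assms(2) b'] in auto)
  also have "\<dots> \<le> restricted_mean m i j (restricted_mean n j j \<phi>) x"
    by (rule minorizesD[OF assms(1) restricted_mean_bounds[of \<phi> B, OF b']])
  also have "\<dots> \<le> restricted_mean (m + n) i j \<phi> x" by (rule restricted_mean_add_ge[of \<phi> B, OF b'])
  finally show "c * c' * foldr avg (Ds @ Es) \<phi> (x - (w + v)) \<le> restricted_mean (m + n) i j \<phi> x" .
qed

lemma minorizes_point: "minorizes n i j w (pmf (walk n (0, i)) (w, j)) []"
  unfolding minorizes_def foldr.simps id_apply by (intro allI impI restricted_mean_ge_point) auto

lemma minorizes_two_points:
  assumes "pmf (walk n (0, i)) (y, j) > 0" "pmf (walk n (0, i)) (y', j) > 0"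
  shows "\<exists>c>0. minorizes n i j y' c [y - y']"
proof (intro exI conjI)
  let ?c = "min (pmf (walk n (0, i)) (y, j)) (pmf (walk n (0, i)) (y', j))"
  show "?c > 0" using assms by simp
  show "minorizes n i j y' ?c [y - y']" unfolding minorizes_def
  proof (intro allI impI)
    fix \<phi> :: "int ^ 'd \<Rightarrow> real" and B x
    assume "\<forall>x. 0 \<le> \<phi> x \<and> \<phi> x \<le> B"
    then have b: "\<And>x. 0 \<le> \<phi> x" "\<And>x. \<phi> x \<le> B" by auto
    have "?c * \<phi> (x - y) \<le> pmf (walk n (0, i)) (y, j) * \<phi> (x - y)"
         "?c * \<phi> (x - y') \<le> pmf (walk n (0, i)) (y', j) * \<phi> (x - y')"
      by (intro mult_right_mono b(1); simp)+
    with restricted_mean_ge_point[of \<phi> B n i y j x, OF b] restricted_mean_ge_point[of \<phi> B n i y' j x, OF b]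
    have *: "?c * \<phi> (x - y) \<le> restricted_mean n i j \<phi> x" "?c * \<phi> (x - y') \<le> restricted_mean n i j \<phi> x" by linarith+
    have "?c * foldr avg [y - y'] \<phi> (x - y') = (?c * \<phi> (x - y') + ?c * \<phi> (x - y)) / 2"
      by (simp add: avg_def distrib_left)
    also have "\<dots> \<le> restricted_mean n i j \<phi> x" using add_mono[OF *] by simp
    finally show "?c * foldr avg [y - y'] \<phi> (x - y') \<le> restricted_mean n i j \<phi> x" .
  qed
qed

text \<open>Choices for different \<open>D\<close> are made independent by performing them one after another, each on an
  excursion that starts and ends in \<open>j\<close>.\<close>

lemma minorizes_list:
  assumes "\<And>D. D \<in> set Ds \<Longrightarrow> \<exists>n\<ge>1. \<exists>y y'. D = y - y' \<and> pmf (walk n (0, j)) (y, j) > 0 \<and> pmf (walk n (0, j)) (y', j) > 0"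
  shows "\<exists>n w c. length Ds \<le> n \<and> 0 < c \<and> minorizes n j j w c Ds"
  using assms
proof (induction Ds)
  case Nil
  have "minorizes 0 j j 0 1 []" using minorizes_point[of 0 j j 0] by simp
  then show ?case by (intro exI[of _ 0] exI[of _ 1]) auto
next
  case (Cons D Ds)
  then obtain n w c where 1: "length Ds \<le> n" "0 < c" "minorizes n j j w c Ds" by (meson list.set_intros(2))
  obtain m y y' where 2: "m \<ge> 1" "D = y - y'" "pmf (walk m (0, j)) (y, j) > 0" "pmf (walk m (0, j)) (y', j) > 0"
    using Cons.prems[of D] by auto
  obtain c' where c': "0 < c'" "minorizes m j j y' c' [D]" using minorizes_two_points[OF 2(3,4)] 2(2) by auto
  have "minorizes (m + n) j j (y' + w) (c' * c) ([D] @ Ds)"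
    by (rule minorizes_trans) (use 1 c' in auto)
  then show ?case using 1 2(1) c' by (intro exI[of _ "m+n"] exI[of _ "y' + w"] exI[of _ "c' * c"]) auto
qed

lemma visits_renewal:
  assumes "T \<ge> 1"
  shows "visits (Suc M) i x \<le> (\<Sum>n<T. hit n i x) + measure_pmf.expectation (walk T (0, i)) (\<lambda>b. visits M (snd b) (x - fst b))"
proof -
  have "visits (Suc M) i x \<le> visits (T + M) i x"
    unfolding visits_def by (rule sum_mono2) (use assms hit_bounds in auto)
  also have "\<dots> = (\<Sum>n<T. hit n i x) + (\<Sum>n<M. hit (T + n) i x)"
    unfolding visits_def by (induction M) auto
  also have "(\<Sum>n<M. hit (T + n) i x) = measure_pmf.expectation (walk T (0, i)) (\<lambda>b. visits M (snd b) (x - fst b))"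
    unfolding visits_def hit_add
    by (subst Bochner_Integration.integral_sum) (auto intro!: integrable_pmf_bounded[where B=1] hit_bounds)
  finally show ?thesis .
qed

lemma visits_bounds: "0 \<le> visits M i x" "visits M i x \<le> M" "\<bar>visits M i x\<bar> \<le> M"
proof -
  show *: "0 \<le> visits M i x" "visits M i x \<le> M"
    unfolding visits_def using sum_mono[of "{..<M}" "\<lambda>n. hit n i x" "\<lambda>_. 1"] by (auto intro: sum_nonneg hit_bounds)
  then show "\<bar>visits M i x\<bar> \<le> M" by simp
qed

text \<open>Let \<open>G\<^sub>N\<close> be the Green function averaged over \<open>N\<close> rounds of the three choices. Decompose the walk
  from \<open>i\<close> after \<open>T i\<close> steps: with probability \<open>c\<close> these steps contain one more round, which turns
  \<open>G\<^sub>N\<close> into \<open>G\<^bsub>N+1\<^esub>\<close>, and otherwise \<open>G\<^sub>N\<close> remains, while the steps themselves contribute at most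
  \<open>T i\<close> times the spreading bound \<open>b N\<close>. The bound \<open>s\<^sub>N\<close> that reproduces itself solves
  \<open>s\<^sub>N = Tm * b N + (1 - c) * s\<^sub>N + c * s\<^bsub>N+1\<^esub>\<close>, so it is \<open>Tm / c\<close> times the tail sum of \<open>b\<close> from \<open>N\<close>.\<close>

theorem visits_bounded:
  assumes inj: "inj (\<lambda>(a::int,b,c). a *s D1 + b *s D2 + c *s D3)"
    and minor: "\<And>i. \<exists>T w c. 1 \<le> T \<and> 0 < c \<and> minorizes T i j w c [D1, D2, D3]"
  shows "\<exists>\<Gamma>>0. \<forall>M i x. visits M i x \<le> \<Gamma>"
proof -
  obtain T w c0 where Twc: "\<And>i. 1 \<le> T i" "\<And>i. 0 < c0 i" "\<And>i. minorizes (T i) i j (w i) (c0 i) [D1, D2, D3]"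
    using minor by metis
  define c where "c = Min (range c0)"
  define Tm where "Tm = Max (range T)"
  have c: "0 < c" "\<And>i. c \<le> c0 i" using Twc(2) by (auto simp: c_def)
  have T: "T i \<le> Tm" for i by (simp add: Tm_def)
  then have Tm: "1 \<le> Tm" using Twc(1) order_trans by blast
  let ?b = "\<lambda>N. (1 / sqrt (real (max 1 N)))^3"
  define \<tau> where "\<tau> N = (\<Sum>k. ?b (k + N))" for N
  have sm: "summable (\<lambda>k. ?b (k + N))" for N by (rule summable_ignore_initial_segment[OF summable_return_bound])
  have \<tau>: "\<tau> N = ?b N + \<tau> (Suc N)" for N
    unfolding \<tau>_def using suminf_split_head[OF sm[of N]] by simp
  have \<tau>0: "0 \<le> \<tau> N" for N unfolding \<tau>_def by (rule suminf_nonneg[OF sm]) simp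
  let ?A = "\<lambda>N. avg3 D1 D2 D3 ^^ N"
  have main: "(?A N) (visits M i) x \<le> Tm / c * \<tau> N" for M N i x
  proof (induction M arbitrary: N i x)
    case 0
    show ?case using \<tau>0[of N] c Tm by (simp add: visits_def[abs_def] avg3_funpow_const)
  next
    case (Suc M)
    define s where "s = Tm / c * \<tau> N"
    let ?F = "\<lambda>k. (?A N) (visits M k)"
    let ?P = "walk (T i) (0, i)"
    have F: "?F k x \<le> s" for k x unfolding s_def by (rule Suc)
    have F0: "0 \<le> ?F k x" for k x
      using avg3_funpow_mono[where f="\<lambda>_. 0" and g="visits M k" and N=N and x=x and ?D1.0=D1 and ?D2.0=D2 and ?D3.0=D3] visits_bounds by (simp add: avg3_funpow_const)
    have s: "0 \<le> s" using \<tau>0[of N] c Tm by (simp add: s_def)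
    have Fi: "integrable ?P (\<lambda>b. ?F (snd b) (x - fst b))"
      by (rule integrable_pmf_bounded[where B=s]) (use F F0 in \<open>auto simp: abs_le_iff intro: order_trans[OF _ s]\<close>)
    have "(?A N) (visits (Suc M) i) x \<le> (?A N) (\<lambda>x. (\<Sum>n<T i. hit n i x) + measure_pmf.expectation ?P (\<lambda>b. visits M (snd b) (x - fst b))) x"
      by (rule avg3_funpow_mono) (rule visits_renewal[OF Twc(1)])
    also have "\<dots> = (?A N) (\<lambda>x. \<Sum>n<T i. hit n i x) x + measure_pmf.expectation ?P (\<lambda>b. ?F (snd b) (x - fst b))"
      unfolding avg3_funpow_add by (subst avg3_funpow_integral[where B="real M"]) (auto intro: visits_bounds)
    also have "(?A N) (\<lambda>x. \<Sum>n<T i. hit n i x) x \<le> real (T i) * ?b N"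
    proof (rule funpow_avg3_le[OF inj])
      fix X :: "(int ^ 'd) set" assume X: "finite X"
      have "(\<Sum>x\<in>X. \<Sum>n<T i. hit n i x) = (\<Sum>n<T i. \<Sum>x\<in>X. hit n i x)" by (rule sum.swap)
      also have "\<dots> \<le> (\<Sum>n<T i. 1)" by (intro sum_mono sum_hit_le X)
      finally show "(\<Sum>x\<in>X. \<Sum>n<T i. hit n i x) \<le> real (T i)" by simp
    qed (auto intro: sum_nonneg hit_bounds)
    also have "real (T i) * ?b N \<le> Tm * ?b N" using T[of i] by (intro mult_right_mono) auto
    also have "measure_pmf.expectation ?P (\<lambda>b. ?F (snd b) (x - fst b)) \<le> s - c * s + c * (Tm / c * \<tau> (Suc N))"
    proof -
      (* minorization bounds means of nonnegative functions from below, hence the complement of F *)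
      let ?\<phi> = "\<lambda>x. s - ?F j x"
      have \<phi>: "0 \<le> ?\<phi> x" "?\<phi> x \<le> s" for x using F F0 by auto
      have a: "foldr avg [D1, D2, D3] ?\<phi> y = s - (?A (Suc N)) (visits M j) y" for y
        by (simp add: avg_diff avg_const avg3_def)
      have "c * (s - Tm / c * \<tau> (Suc N)) \<le> c * foldr avg [D1, D2, D3] ?\<phi> (x - w i)"
        unfolding a using Suc[of "Suc N" j "x - w i"] c by (intro mult_left_mono diff_left_mono) auto
      also have "\<dots> \<le> c0 i * foldr avg [D1, D2, D3] ?\<phi> (x - w i)"
      proof (intro mult_right_mono c)
        show "0 \<le> foldr avg [D1, D2, D3] ?\<phi> (x - w i)"
          using foldr_avg_mono[of "\<lambda>_. 0" ?\<phi> "[D1, D2, D3]" "x - w i"] \<phi> by (simp add: avg_const)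
      qed
      also have "\<dots> \<le> restricted_mean (T i) i j ?\<phi> x" by (rule minorizesD[OF Twc(3) \<phi>])
      also have "\<dots> \<le> measure_pmf.expectation ?P (\<lambda>b. s - ?F (snd b) (x - fst b))"
        unfolding restricted_mean_def
        by (intro integral_mono integrable_pmf_bounded[where B=s] Bochner_Integration.integrable_diff Fi) (use F F0 s in auto)
      also have "\<dots> = s - measure_pmf.expectation ?P (\<lambda>b. ?F (snd b) (x - fst b))"
        by (subst Bochner_Integration.integral_diff) (auto intro: Fi)
      finally show ?thesis by (simp add: algebra_simps)
    qed
    also have "Tm * ?b N + (s - c * s + c * (Tm / c * \<tau> (Suc N))) = s"
      unfolding s_def \<tau>[of N] using c by (simp add: field_simps)
    finally show ?case by (simp add: s_def)
  qed
  have "visits M i x \<le> Tm / c * \<tau> 0 + 1" for M i x using main[of 0 M i x] by simp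
  moreover have "Tm / c * \<tau> 0 + 1 > 0" using \<tau>0[of 0] c by (intro add_nonneg_pos) auto
  ultimately show ?thesis by blast
qed

end

section \<open>The chain of internal states and transience\<close>

context walk_kernel
begin

definition inner_matrix :: "real ^ 'e ^ 'e" where
  "inner_matrix = (\<chi> j k. measure_pmf.prob (K (0, j)) {b. snd b = k})"

lemma expectation_inner_state:
  "measure_pmf.expectation (K a) (\<lambda>b. g (snd b)) = (inner_matrix *v vec_lambda g) $ snd a"
proof -
  have K: "K a = map_pmf (apfst ((+) (fst a))) (K (0, snd a))" using shift[of "fst a" 0 "snd a"] by simp
  have "measure_pmf.expectation (K a) (\<lambda>b. g (snd b)) = measure_pmf.expectation (map_pmf snd (K (0, snd a))) g"
    by (subst K) simp
  also have "\<dots> = (\<Sum>k\<in>UNIV. g k * pmf (map_pmf snd (K (0, snd a))) k)"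
    by (rule integral_measure_pmf_real) auto
  also have "\<dots> = (inner_matrix *v vec_lambda g) $ snd a"
    by (simp add: matrix_vector_mult_def inner_matrix_def pmf_map vimage_def mult.commute)
  finally show ?thesis .
qed

lemma inner_matrix_stochastic: "(\<Sum>k\<in>UNIV. inner_matrix $ j $ k) = 1" "0 \<le> inner_matrix $ j $ k"
  using expectation_inner_state[of "(0, j)" "\<lambda>_. 1"]
  by (simp_all add: matrix_vector_mult_def) (simp add: inner_matrix_def)

lemma mat_power_inner_matrix:
  "mat_power inner_matrix n $ j $ k = measure_pmf.prob (walk n (0, j)) {b. snd b = k}"
proof (induction n arbitrary: j)
  case 0
  show ?case by (simp add: mat_power_def mat_def indicator_def)
next
  case (Suc n)
  let ?S = "{b::(int ^ 'd) \<times> 'e. snd b = k}"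
  have from_b: "measure_pmf.prob (walk n b) ?S = measure_pmf.prob (walk n (0, snd b)) ?S" for b
    by (subst walk_from) (simp add: vimage_def)
  have "measure_pmf.prob (walk (Suc n) (0, j)) ?S = measure_pmf.expectation (walk (1 + n) (0, j)) (indicator ?S)" by simp
  also have "\<dots> = measure_pmf.expectation (K (0, j)) (\<lambda>b. measure_pmf.expectation (walk n b) (indicator ?S))"
    unfolding walk_add by (subst integral_pmf_bind[where B=1]) (auto simp: indicator_def bind_return_pmf)
  also have "\<dots> = measure_pmf.expectation (K (0, j)) (\<lambda>b. measure_pmf.prob (walk n (0, snd b)) ?S)"
    by (simp add: from_b[symmetric])
  also have "\<dots> = (inner_matrix *v (\<chi> l. measure_pmf.prob (walk n (0, l)) ?S)) $ j"
    using expectation_inner_state[of "(0, j)" "\<lambda>l. measure_pmf.prob (walk n (0, l)) ?S"] by simp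
  also have "\<dots> = mat_power inner_matrix (Suc n) $ j $ k"
    by (simp add: mat_power_def matrix_vector_mult_def matrix_matrix_mult_def Suc[unfolded mat_power_def])
  finally show ?case ..
qed

text \<open>The choices are available from the state \<open>j\<close>; from any other state the walk first moves to \<open>j\<close>, which
  irreducibility permits. The number of steps that this takes may depend on the state.\<close>

theorem visits_bounded_of_irreducible:
  assumes irr: "irreducible_mat inner_matrix"
    and inj: "inj (\<lambda>(a::int,b,c). a *s D1 + b *s D2 + c *s D3)"
    and D: "\<And>D. D \<in> {D1, D2, D3} \<Longrightarrow> \<exists>n\<ge>1. \<exists>y y'. D = y - y' \<and> pmf (walk n (0, j)) (y, j) > 0 \<and> pmf (walk n (0, j)) (y', j) > 0"
  shows "\<exists>\<Gamma>>0. \<forall>M i x. visits M i x \<le> \<Gamma>"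
proof (rule visits_bounded[OF inj])
  fix i
  obtain n w c where nwc: "3 \<le> n" "0 < c" "minorizes n j j w c [D1, D2, D3]"
    using minorizes_list[of "[D1, D2, D3]" j] D by (auto simp: numeral_3_eq_3)
  obtain m where "mat_power inner_matrix m $ i $ j > 0" using irr unfolding irreducible_mat_def by blast
  then have "set_pmf (walk m (0, i)) \<inter> {b. snd b = j} \<noteq> {}"
    unfolding mat_power_inner_matrix using measure_Int_set_pmf[of "walk m (0, i)" "{b. snd b = j}"] by (auto simp: Int_commute)
  then obtain b where "b \<in> set_pmf (walk m (0, i))" "snd b = j" by blast
  then obtain z where z: "pmf (walk m (0, i)) (z, j) > 0"
    using pmf_positive[of b "walk m (0, i)"] by (cases b) auto
  have "minorizes (m + n) i j (z + w) (pmf (walk m (0, i)) (z, j) * c) ([] @ [D1, D2, D3])"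
    by (rule minorizes_trans[OF minorizes_point nwc(3)]) (use nwc z in auto)
  then show "\<exists>T w c. 1 \<le> T \<and> 0 < c \<and> minorizes T i j w c [D1, D2, D3]"
    using z nwc by (intro exI[of _ "m + n"] exI[of _ "z + w"] exI[of _ "pmf (walk m (0, i)) (z, j) * c"]) auto
qed

end

text \<open>A set that generates the lattice as a group spans the real vector space, so it contains a basis
  of it. Independence over the reals implies injectivity on integer combinations.\<close>

lemma three_independent_directions:
  fixes S :: "(int ^ 'd) set"
  assumes d: "CARD('d) \<ge> 3" and gen: "group_closure S = UNIV"
  shows "\<exists>D1\<in>S. \<exists>D2\<in>S. \<exists>D3\<in>S. inj (\<lambda>(a::int,b,c). a *s D1 + b *s D2 + c *s D3)"
proof -
  let ?r = "\<lambda>y::int ^ 'd. \<chi> l. real_of_int (y $ l)"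
  have r_diff: "?r (x - y) = ?r x - ?r y" for x y by (simp add: vec_eq_iff)
  have "?r x \<in> span (?r ` S)" for x
  proof -
    have "x \<in> group_closure S" using gen by simp
    then show ?thesis
    proof induction
      case (base s)
      have "?r 0 = 0" by (simp add: vec_eq_iff)
      with base show ?case by (auto intro: span_base span_zero)
    qed (simp only: r_diff span_diff)
  qed
  moreover have "?r (axis i 1) = axis i 1" for i by (simp add: vec_eq_iff axis_def)
  ultimately have "axis i 1 \<in> span (?r ` S)" for i by metis
  then have "Basis \<subseteq> span (?r ` S)" by (auto simp: Basis_vec_def)
  then have span: "span (?r ` S) = UNIV" using span_mono[of Basis "span (?r ` S)"] by (auto simp: span_span)
  obtain B where B: "B \<subseteq> ?r ` S" "independent B" "?r ` S \<subseteq> span B" by (rule maximal_independent_subset)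
  have "span B = UNIV" using span_mono[OF B(3)] by (auto simp: span span_span)
  then have "card B = dim (UNIV :: (real ^ 'd) set)" using B(2) using dim_span[of B] dim_eq_card_independent[of B] by simp
  then have "card B \<ge> 3" using d by (simp add: dim_UNIV)
  then obtain C where C: "C \<subseteq> B" "card C = 3" by (meson obtain_subset_with_card_n)
  then obtain u1 u2 u3 where u: "C = {u1, u2, u3}" "u1 \<noteq> u2" "u2 \<noteq> u3" "u1 \<noteq> u3" by (metis card_3_iff)
  then have "u1 \<in> ?r ` S" "u2 \<in> ?r ` S" "u3 \<in> ?r ` S" using C(1) B(1) by auto
  then obtain D1 D2 D3 where D: "D1 \<in> S" "D2 \<in> S" "D3 \<in> S" "u1 = ?r D1" "u2 = ?r D2" "u3 = ?r D3"
    by (elim imageE) (rule that)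
  have ind: "independent C" using B(2) C(1) independent_mono by blast
  have "inj (\<lambda>(a::int,b,c). a *s D1 + b *s D2 + c *s D3)"
  proof (rule injI)
    fix s t assume st: "(\<lambda>(a::int,b,c). a *s D1 + b *s D2 + c *s D3) s = (\<lambda>(a::int,b,c). a *s D1 + b *s D2 + c *s D3) t"
    obtain a b c a' b' c' where s: "s = (a, b, c)" and t: "t = (a', b', c')" by (metis prod_cases3)
    have e: "a *s D1 + b *s D2 + c *s D3 = a' *s D1 + b' *s D2 + c' *s D3" using st by (simp add: s t)
    define f where "f v = (if v = u1 then real_of_int (a - a') else if v = u2 then real_of_int (b - b') else real_of_int (c - c'))" for v
    have "real_of_int (a - a') *\<^sub>R u1 + real_of_int (b - b') *\<^sub>R u2 + real_of_int (c - c') *\<^sub>R u3 = 0"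
    proof (subst vec_eq_iff, intro allI)
      fix i
      have "(a *s D1 + b *s D2 + c *s D3) $ i = (a' *s D1 + b' *s D2 + c' *s D3) $ i" by (simp only: e)
      then have "(a - a') * D1 $ i + (b - b') * D2 $ i + (c - c') * D3 $ i = 0" by (simp add: algebra_simps)
      then have "real_of_int ((a - a') * D1 $ i + (b - b') * D2 $ i + (c - c') * D3 $ i) = 0" by (simp only: of_int_0)
      then show "(real_of_int (a - a') *\<^sub>R u1 + real_of_int (b - b') *\<^sub>R u2 + real_of_int (c - c') *\<^sub>R u3) $ i = 0 $ i"
        unfolding D by simp
    qed
    then have "(\<Sum>v\<in>C. f v *\<^sub>R v) = 0" using u by (simp add: f_def algebra_simps)
    then have "\<forall>v\<in>C. f v = 0" using independentD[OF ind, of C f] C(2) card_ge_0_finite[of C] by auto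
    then show "s = t" using u by (auto simp: f_def s t)
  qed
  with D show ?thesis by blast
qed

definition rw_kernel :: "(int ^ 'd \<Rightarrow> 'e::finite \<Rightarrow> 'e \<Rightarrow> real) \<Rightarrow> (int ^ 'd) \<times> 'e \<Rightarrow> ((int ^ 'd) \<times> 'e) pmf" where
  "rw_kernel p a = embed_pmf (transition p a)"

lemma pmf_rw_kernel:
  assumes "jump_probabilities p"
  shows "pmf (rw_kernel p a) b = transition p a b"
  unfolding rw_kernel_def
proof (rule pmf_embed_pmf)
  show nonneg: "0 \<le> transition p a b" for b
    using assms by (simp add: transition_def jump_probabilities_def)
  have "((\<lambda>(y, k). p y (snd a) k) has_sum 1) UNIV"
    using assms by (simp add: jump_probabilities_def)
  moreover have "bij_betw (\<lambda>b. (fst b - fst a, snd b)) UNIV (UNIV :: ((int ^ 'a) \<times> 'b) set)"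
    by (rule bij_betwI[where g="\<lambda>b. (fst b + fst a, snd b)"]) auto
  ultimately have "((\<lambda>b. (\<lambda>(y, k). p y (snd a) k) (fst b - fst a, snd b)) has_sum 1) UNIV"
    by (subst has_sum_reindex_bij_betw)
  then have s: "(transition p a has_sum 1) UNIV" by (simp add: transition_def[abs_def])
  then have "transition p a summable_on UNIV" by (rule has_sum_imp_summable)
  then have abs: "Infinite_Set_Sum.abs_summable_on (transition p a) UNIV"
    using nonneg by (simp add: abs_summable_equivalent[symmetric])
  then have "(\<integral>\<^sup>+b. ennreal (transition p a b) \<partial>count_space UNIV) = ennreal (infsum (transition p a) UNIV)"
    using nonneg by (simp add: nn_integral_conv_infsetsum infsetsum_infsum)
  then show "(\<integral>\<^sup>+b. ennreal (transition p a b) \<partial>count_space UNIV) = 1"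
    using infsumI[OF s] by simp
qed

lemma walk_kernel_rw_kernel:
  assumes "jump_probabilities p"
  shows "walk_kernel (rw_kernel p)"
proof
  fix u x :: "int ^ 'a" and j :: 'b
  have inj: "inj (apfst ((+) u) :: (int ^ 'a) \<times> 'b \<Rightarrow> _)" by (auto intro!: injI simp: prod_eq_iff)
  show "rw_kernel p (u + x, j) = map_pmf (apfst ((+) u)) (rw_kernel p (x, j))"
  proof (rule pmf_eqI)
    fix b :: "(int ^ 'a) \<times> 'b"
    have b: "b = apfst ((+) u) (fst b - u, snd b)" by (simp add: prod_eq_iff)
    show "pmf (rw_kernel p (u + x, j)) b = pmf (map_pmf (apfst ((+) u)) (rw_kernel p (x, j))) b"
      by (subst (2) b, subst pmf_map_inj'[OF inj])
         (simp add: pmf_rw_kernel[OF assms] transition_def diff_diff_eq)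
  qed
qed

lemma infsum_pmf_mult:
  assumes "\<And>x. \<bar>f x\<bar> \<le> B"
  shows "(\<Sum>\<^sub>\<infinity>x. pmf P x * f x) = measure_pmf.expectation P f"
proof -
  have "Infinite_Set_Sum.abs_summable_on (\<lambda>x. pmf P x * f x) UNIV"
  proof (rule abs_summable_on_comparison_test')
    show "Infinite_Set_Sum.abs_summable_on (\<lambda>x. B * pmf P x) UNIV"
      by (intro abs_summable_on_cmult_right pmf_abs_summable)
    show "norm (pmf P x * f x) \<le> B * pmf P x" for x
      using mult_left_mono[OF assms, of "pmf P x" x] by (simp add: abs_mult mult.commute)
  qed
  then show ?thesis by (simp add: infsetsum_infsum[symmetric] pmf_expectation_eq_infsetsum)
qed

lemma pmf_has_sum: "(pmf P has_sum measure_pmf.prob P A) A"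
proof -
  have "pmf P summable_on A"
    using pmf_abs_summable[of P A] by (simp add: abs_summable_equivalent[symmetric])
  moreover have "infsum (pmf P) A = measure_pmf.prob P A"
    by (simp add: measure_pmf_conv_infsetsum infsetsum_infsum[OF pmf_abs_summable])
  ultimately show ?thesis by (metis has_sum_infsum)
qed

text \<open>The matrices of the walk are sums in a space of vectors; this reduces them to entries.\<close>

lemma has_sum_vec:
  assumes "\<And>i. ((\<lambda>x. f x $ i) has_sum S $ i) A"
  shows "(f has_sum S) A"
  using assms unfolding has_sum_def by (intro vec_tendstoI) simp

context
  fixes p :: "int ^ 'd \<Rightarrow> 'e::finite \<Rightarrow> 'e \<Rightarrow> real"
  assumes p: "jump_probabilities p"
begin

interpretation walk_kernel "rw_kernel p" by (rule walk_kernel_rw_kernel[OF p])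

lemma nstep_transition_eq_walk: "nstep_transition p n a b = pmf (walk n a) b"
proof (induction n arbitrary: b)
  case (Suc n)
  have "(\<Sum>\<^sub>\<infinity>c. pmf (walk n a) c * pmf (rw_kernel p c) b) = measure_pmf.expectation (walk n a) (\<lambda>c. pmf (rw_kernel p c) b)"
    by (rule infsum_pmf_mult[where B=1]) (simp add: pmf_le_1)
  then show ?case by (simp add: Suc pmf_rw_kernel[OF p] pmf_bind)
qed (simp add: indicator_def)

lemma Q_mat_eq_inner_matrix: "Q_mat p = inner_matrix"
  unfolding Q_mat_def
proof (rule infsumI, intro has_sum_vec)
  fix j k
  have "(pmf (rw_kernel p (0, j)) has_sum inner_matrix $ j $ k) {b. snd b = k}"
    unfolding inner_matrix_def by (simp add: pmf_has_sum)
  also have "{b. snd b = k} = (\<lambda>y. (y, k)) ` UNIV" by (auto simp: image_iff prod_eq_iff)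
  finally have "(pmf (rw_kernel p (0, j)) \<circ> (\<lambda>y. (y, k)) has_sum inner_matrix $ j $ k) UNIV"
    by (subst (asm) has_sum_reindex) (auto intro: inj_onI)
  then show "((\<lambda>y. A_mat p y $ j $ k) has_sum inner_matrix $ j $ k) UNIV"
    by (simp add: o_def pmf_rw_kernel[OF p] transition_def A_mat_def)
qed

end

theorem rwwis_transient:
  fixes p :: "int ^ 'd \<Rightarrow> 'e::finite \<Rightarrow> 'e \<Rightarrow> real"
  assumes p: "jump_probabilities p" and d: "CARD('d) \<ge> 3"
    and irr: "irreducible_mat (Q_mat p)" and arith: "trivial_arithmetic p"
  shows "\<exists>\<Gamma>>0. \<forall>M i x. walk_kernel.visits (rw_kernel p) M i x \<le> \<Gamma>"
proof -
  interpret walk_kernel "rw_kernel p" by (rule walk_kernel_rw_kernel[OF p])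
  fix j :: 'e
  let ?S = "{y - y' | y y'. \<exists>n\<ge>1. nstep_transition p n (0, j) (y, j) > 0 \<and> nstep_transition p n (0, j) (y', j) > 0}"
  have "group_closure ?S = UNIV" using arith unfolding trivial_arithmetic_def by blast
  from three_independent_directions[OF d this] obtain D1 D2 D3
    where D: "D1 \<in> ?S" "D2 \<in> ?S" "D3 \<in> ?S" and inj: "inj (\<lambda>(a::int,b,c). a *s D1 + b *s D2 + c *s D3)"
    by blast
  show ?thesis
  proof (rule visits_bounded_of_irreducible[OF _ inj])
    show "irreducible_mat inner_matrix" using irr by (simp add: Q_mat_eq_inner_matrix[OF p])
    fix D assume "D \<in> {D1, D2, D3}"
    then have "D \<in> ?S" using D by auto
    then show "\<exists>n\<ge>1. \<exists>y y'. D = y - y' \<and> pmf (walk n (0, j)) (y, j) > 0 \<and> pmf (walk n (0, j)) (y', j) > 0"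
      unfolding nstep_transition_eq_walk[OF p] by blast
  qed
qed

section \<open>The Poisson equation of a finite irreducible chain\<close>

text \<open>The map \<open>v \<mapsto> v - Q v + \<langle>\<mu>, v\<rangle> 1\<close> is injective, hence surjective: pairing with \<open>\<mu>\<close> shows that a vector
  \<open>v\<close> of the kernel satisfies \<open>\<langle>\<mu>, v\<rangle> = 0\<close> and \<open>Q v = v\<close>, and by the maximum principle a harmonic vector of an
  irreducible chain is constant.\<close>

lemma poisson_equation:
  fixes Q :: "real ^ 'e::finite ^ 'e"
  assumes rows: "\<And>j. (\<Sum>k\<in>UNIV. Q $ j $ k) = 1" and nonneg: "\<And>j k. 0 \<le> Q $ j $ k"
    and irr: "irreducible_mat Q" and stat: "stationary_distribution Q \<mu>"
  shows "\<exists>v c. \<forall>j. h $ j = c + v $ j - (Q *v v) $ j"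
proof -
  let ?f = "\<lambda>v. v - Q *v v + (\<mu> \<bullet> v) *\<^sub>R 1"
  have lin: "linear ?f"
    by (intro linearI)
       (simp_all add: matrix_vector_right_distrib inner_add_right scaleR_add_left scaleR_diff_right matrix_vector_mult_scaleR algebra_simps)
  have \<mu>1: "\<mu> \<bullet> 1 = 1" using stat by (simp add: stationary_distribution_def inner_vec_def)
  have \<mu>Q: "\<mu> \<bullet> (Q *v v) = \<mu> \<bullet> v" for v
    using stat dot_lmul_matrix[of \<mu> Q v] by (simp add: stationary_distribution_def)
  have pow: "0 \<le> mat_power Q n $ j $ k" "(\<Sum>k\<in>UNIV. mat_power Q n $ j $ k) = 1" for n j k
  proof (induction n arbitrary: j k)
    case 0
    { case 1 show ?case by (simp add: mat_power_def mat_def) }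
    { case 2 show ?case by (simp add: mat_power_def mat_def) }
  next
    case (Suc n)
    have e: "mat_power Q (Suc n) $ j $ k = (\<Sum>l\<in>UNIV. Q $ j $ l * mat_power Q n $ l $ k)" for j k
      by (simp add: mat_power_def matrix_matrix_mult_def)
    { case 1 show ?case unfolding e by (intro sum_nonneg mult_nonneg_nonneg nonneg Suc) }
    { case 2
      have "(\<Sum>k\<in>UNIV. mat_power Q (Suc n) $ j $ k) = (\<Sum>l\<in>UNIV. Q $ j $ l * (\<Sum>k\<in>UNIV. mat_power Q n $ l $ k))"
        unfolding e sum_distrib_left by (rule sum.swap)
      then show ?case by (simp add: Suc rows) }
  qed
  have "v = 0" if "?f v = 0" for v
  proof -
    have "\<mu> \<bullet> ?f v = \<mu> \<bullet> v" by (simp add: inner_diff_right inner_add_right \<mu>1 \<mu>Q)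
    with that have \<mu>v: "\<mu> \<bullet> v = 0" by simp
    with that have Qv: "Q *v v = v" by simp
    have Pv: "mat_power Q n *v v = v" for n
    proof (induction n)
      case (Suc n)
      have "mat_power Q (Suc n) *v v = Q *v (mat_power Q n *v v)"
        by (simp add: mat_power_def matrix_vector_mul_assoc)
      then show ?case by (simp add: Suc Qv)
    qed (simp add: mat_power_def)
    obtain i where i: "\<And>k. v $ k \<le> v $ i"
    proof -
      have "Max (range (($) v)) \<in> range (($) v)" by (rule Max_in) auto
      then obtain i where e: "Max (range (($) v)) = v $ i" by blast
      have "v $ k \<le> v $ i" for k unfolding e[symmetric] by (rule Max_ge) auto
      then show ?thesis by (rule that)
    qed
    (* the mean of v over the states reachable from i equals the maximum v $ i *)
    have eq: "v $ k = v $ i" for k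
    proof -
      obtain n where n: "mat_power Q n $ i $ k > 0" using irr unfolding irreducible_mat_def by blast
      have "(\<Sum>l\<in>UNIV. mat_power Q n $ i $ l * (v $ i - v $ l)) = v $ i * (\<Sum>l\<in>UNIV. mat_power Q n $ i $ l) - (mat_power Q n *v v) $ i"
        by (simp add: matrix_vector_mult_def right_diff_distrib sum_subtractf sum_distrib_left mult.commute)
      also have "\<dots> = 0" by (simp add: pow Pv)
      finally have "\<forall>l\<in>UNIV. mat_power Q n $ i $ l * (v $ i - v $ l) = 0"
        by (subst (asm) sum_nonneg_eq_0_iff) (auto intro!: mult_nonneg_nonneg pow i)
      then have "mat_power Q n $ i $ k * (v $ i - v $ k) = 0" by blast
      then show ?thesis using n by simp
    qed
    have "\<mu> \<bullet> v = (\<Sum>k\<in>UNIV. \<mu> $ k) * v $ i"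
      unfolding inner_vec_def sum_distrib_right by (intro sum.cong refl) (subst eq, simp)
    then have "v $ i = 0" using \<mu>v stat by (simp add: stationary_distribution_def)
    then have "v $ k = 0" for k using eq[of k] by simp
    then show ?thesis by (simp add: vec_eq_iff)
  qed
  then have "inj ?f" using linear_injective_0[OF lin] by blast
  then have "surj ?f" by (rule linear_inj_imp_surj[OF lin])
  then obtain v where "h = ?f v" by (meson surjD)
  then have "\<forall>j. h $ j = (\<mu> \<bullet> v) + v $ j - (Q *v v) $ j" by simp
  then show ?thesis by blast
qed

section \<open>Markov property along the whole past\<close>

text \<open>The law of the past is put into this form so that it can be composed with the kernel by
  \<open>bind_pmf\<close>.\<close>

lemma (in prob_space) distr_countable_pmf:
  fixes X :: "'a \<Rightarrow> 's::countable"
  assumes X: "X \<in> measurable M (count_space UNIV)"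
  obtains \<rho> where "distr M (count_space UNIV) X = measure_pmf \<rho>"
proof -
  let ?D = "distr M (count_space UNIV) X"
  have D: "prob_space ?D" by (rule prob_space_distr[OF X])
  interpret D: prob_space ?D by (rule D)
  have "AE x in ?D. measure ?D {x} = 0 \<longrightarrow> x \<noteq> y" for y
  proof (cases "measure ?D {y} = 0")
    case True
    then have "{y} \<in> null_sets ?D" by (intro null_setsI) (simp_all add: D.emeasure_eq_measure)
    then show ?thesis by (rule AE_I'[OF _ ]) auto
  qed auto
  then have "AE x in ?D. \<forall>y\<in>UNIV. measure ?D {x} = 0 \<longrightarrow> x \<noteq> y"
    by (subst AE_ball_countable) auto
  then have "AE x in ?D. measure ?D {x} \<noteq> 0" by (rule AE_mp) auto
  then have "measure_pmf (Abs_pmf ?D) = ?D" using D by (intro Abs_pmf_inverse) simp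
  then show ?thesis using that by metis
qed

locale markov_process = prob_space W for W :: "'w measure" +
  fixes \<xi> :: "nat \<Rightarrow> 'w \<Rightarrow> 's::countable" and K :: "'s \<Rightarrow> 's pmf"
  assumes measurable_\<xi>: "\<xi> n \<in> measurable W (count_space UNIV)"
    and markov_singleton: "measure W {w\<in>space W. (\<forall>i\<le>n. \<xi> i w = x i) \<and> \<xi> (Suc n) w = b}
        = measure W {w\<in>space W. \<forall>i\<le>n. \<xi> i w = x i} * pmf (K (x n)) b"
begin

declare measurable_\<xi> [measurable]

text \<open>Lists are used because a countable type of histories makes every function of the past
  measurable.\<close>

definition past :: "nat \<Rightarrow> 'w \<Rightarrow> 's list" where
  "past n w = map (\<lambda>i. \<xi> i w) [0..<Suc n]"

lemma length_past [simp]: "length (past n w) = Suc n"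
  and last_past [simp]: "last (past n w) = \<xi> n w"
  and nth_past: "i \<le> n \<Longrightarrow> past n w ! i = \<xi> i w"
  and take_past: "i \<le> n \<Longrightarrow> take (Suc i) (past n w) = past i w"
  by (simp_all add: past_def take_map last_map nth_append del: upt_Suc)

lemma past_eq_iff: "length xs = Suc n \<Longrightarrow> past n w = xs \<longleftrightarrow> (\<forall>i\<le>n. \<xi> i w = xs ! i)"
  by (simp add: list_eq_iff_nth_eq nth_past less_Suc_eq_le)

lemma measurable_past [measurable]: "past n \<in> measurable W (count_space UNIV)"
proof (rule measurable_count_space_eq_countable[THEN iffD2], simp, safe)
  fix xs :: "'s list"
  show "past n -` {xs} \<inter> space W \<in> events"
  proof (cases "length xs = Suc n")
    case True
    have "past n -` {xs} \<inter> space W = {w\<in>space W. \<forall>i\<le>n. \<xi> i w = xs ! i}"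
      using past_eq_iff[OF True] by auto
    then show ?thesis by simp
  next
    case False
    then have "past n -` {xs} \<inter> space W = {}" by (auto dest: arg_cong[where f=length])
    then show ?thesis by simp
  qed
qed simp_all

text \<open>The joint law of the past and the next state is determined by its point masses, and these are
  products by assumption.\<close>

lemma markov:
  fixes \<Phi> :: "'s list \<Rightarrow> 's \<Rightarrow> real"
  assumes B: "\<And>xs b. \<bar>\<Phi> xs b\<bar> \<le> B"
  shows "expectation (\<lambda>w. \<Phi> (past n w) (\<xi> (Suc n) w)) = expectation (\<lambda>w. measure_pmf.expectation (K (\<xi> n w)) (\<Phi> (past n w)))"
proof -
  obtain \<rho> where \<rho>: "distr W (count_space UNIV) (past n) = measure_pmf \<rho>"
    using distr_countable_pmf[OF measurable_past] .
  let ?X = "\<lambda>w. (past n w, \<xi> (Suc n) w)"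
  have X[measurable]: "?X \<in> measurable W (count_space UNIV)"
    using measurable_Pair[OF measurable_past measurable_\<xi>] by (simp add: pair_measure_countable)
  let ?\<nu> = "bind_pmf \<rho> (\<lambda>xs. map_pmf (Pair xs) (K (last xs)))"
  have "distr W (count_space UNIV) ?X = measure_pmf ?\<nu>"
  proof (rule measure_eqI_countable[where A=UNIV])
    fix a :: "'s list \<times> 's"
    obtain xs b where a: "a = (xs, b)" by (cases a)
    have "pmf (map_pmf (Pair ys) (K (last ys))) (xs, b) = indicator {xs} ys * pmf (K (last xs)) b" for ys
    proof (cases "ys = xs")
      case True
      then show ?thesis using pmf_map_inj'[of "Pair xs" "K (last xs)" b] by (simp add: inj_on_def)
    next
      case False
      then show ?thesis by (auto simp: pmf_map vimage_def)
    qed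
    then have "pmf ?\<nu> (xs, b) = pmf \<rho> xs * pmf (K (last xs)) b"
      by (simp add: pmf_bind measure_pmf_single)
    moreover have "pmf \<rho> xs = prob {w\<in>space W. past n w = xs}"
      by (simp add: measure_pmf_single[symmetric] \<rho>[symmetric] measure_distr vimage_def Int_def conj_commute)
    moreover have "prob {w\<in>space W. past n w = xs \<and> \<xi> (Suc n) w = b} = prob {w\<in>space W. past n w = xs} * pmf (K (last xs)) b"
    proof (cases "length xs = Suc n")
      case True
      then have "last xs = xs ! n" by (metis last_conv_nth diff_Suc_1 length_0_conv nat.distinct(1))
      then show ?thesis using markov_singleton[of n "(!) xs" b] by (simp add: past_eq_iff[OF True])
    next
      case False
      then have "past n w \<noteq> xs" for w by auto
      then show ?thesis by simp
    qed
    moreover have "emeasure (distr W (count_space UNIV) ?X) {a} = ennreal (prob {w\<in>space W. past n w = xs \<and> \<xi> (Suc n) w = b})"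
      by (simp add: a emeasure_distr emeasure_eq_measure vimage_def Int_def conj_commute)
    ultimately show "emeasure (distr W (count_space UNIV) ?X) {a} = emeasure (measure_pmf ?\<nu>) {a}"
      by (simp add: a emeasure_pmf_single)
  qed auto
  then have "expectation (\<lambda>w. \<Phi> (past n w) (\<xi> (Suc n) w)) = measure_pmf.expectation ?\<nu> (\<lambda>(xs, b). \<Phi> xs b)"
    using integral_distr[OF X, of "\<lambda>(xs, b). \<Phi> xs b"] by simp
  also have "\<dots> = measure_pmf.expectation \<rho> (\<lambda>xs. measure_pmf.expectation (K (last xs)) (\<Phi> xs))"
    by (subst integral_pmf_bind[where B=B]) (use B in auto)
  also have "\<dots> = expectation (\<lambda>w. measure_pmf.expectation (K (\<xi> n w)) (\<Phi> (past n w)))"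
    using integral_distr[OF measurable_past, of "\<lambda>xs. measure_pmf.expectation (K (last xs)) (\<Phi> xs)" n] by (simp add: \<rho>)
  finally show ?thesis .
qed

end

section \<open>Counting the values of a sequence\<close>

lemma card_image_last_visits:
  fixes \<eta> :: "nat \<Rightarrow> 'a"
  shows "card (\<eta> ` {..n}) = (\<Sum>k\<le>n. of_bool (\<forall>i\<in>{k<..n}. \<eta> i \<noteq> \<eta> k))"
proof -
  let ?L = "{k\<in>{..n}. \<forall>i\<in>{k<..n}. \<eta> i \<noteq> \<eta> k}"
  have inj: "inj_on \<eta> ?L"
  proof (rule inj_onI)
    fix k l assume "k \<in> ?L" "l \<in> ?L" "\<eta> k = \<eta> l"
    then show "k = l" by (cases k l rule: linorder_cases) auto
  qed
  have "\<eta> ` {..n} \<subseteq> \<eta> ` ?L"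
  proof
    fix x assume "x \<in> \<eta> ` {..n}"
    then obtain i where i: "i \<le> n" "\<eta> i = x" by auto
    let ?A = "{k. k \<le> n \<and> \<eta> k = x}"
    (* the last visit to x *)
    obtain k where k: "k \<in> ?A" "\<And>l. l \<in> ?A \<Longrightarrow> l \<le> k"
    proof (rule that)
      show "Max ?A \<in> ?A" using i by (intro Max_in) auto
      show "l \<le> Max ?A" if "l \<in> ?A" for l using that by (intro Max_ge) auto
    qed
    have "\<eta> l \<noteq> \<eta> k" if "l \<in> {k<..n}" for l
      using k(1) k(2)[of l] that by auto
    with k(1) show "x \<in> \<eta> ` ?L" by (intro image_eqI[of _ _ k]) auto
  qed
  then have eq: "\<eta> ` {..n} = \<eta> ` ?L" by auto
  have "card (\<eta> ` {..n}) = card ?L" unfolding eq by (rule card_image[OF inj])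
  also have "\<dots> = (\<Sum>k\<le>n. of_bool (\<forall>i\<in>{k<..n}. \<eta> i \<noteq> \<eta> k))"
    by (simp add: of_bool_def sum.If_cases Int_def)
  finally show ?thesis .
qed

text \<open>If \<open>N x\<close> is the number of visits to \<open>x\<close>, expand \<open>0 \<le> (1 - t * N x)\<^sup>2\<close> and sum over the values \<open>x\<close>: the
  sum of the \<open>N x\<close> is \<open>n + 1\<close>, that of their squares is the number of coincidences. Optimising
  over \<open>t\<close> would give the Cauchy-Schwarz bound, but the linear form in the coincidences survives taking
  expectations.\<close>

lemma card_image_ge:
  fixes \<eta> :: "nat \<Rightarrow> 'a" and t :: real
  shows "2 * t * real (n+1) - t\<^sup>2 * (\<Sum>i\<le>n. \<Sum>k\<le>n. of_bool (\<eta> i = \<eta> k)) \<le> real (card (\<eta> ` {..n}))"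
proof -
  let ?R = "\<eta> ` {..n}"
  define N where "N x = (\<Sum>i\<le>n. of_bool (\<eta> i = x) :: real)" for x
  have "(\<Sum>x\<in>?R. N x) = (\<Sum>i\<le>n. \<Sum>x\<in>?R. of_bool (\<eta> i = x))" unfolding N_def by (rule sum.swap)
  also have "\<dots> = (\<Sum>i\<le>n. 1)" by (intro sum.cong refl) (simp add: of_bool_def)
  finally have 1: "(\<Sum>x\<in>?R. N x) = real (n+1)" by simp
  have "(\<Sum>x\<in>?R. (N x)\<^sup>2) = (\<Sum>x\<in>?R. \<Sum>i\<le>n. \<Sum>k\<le>n. of_bool (\<eta> i = x) * of_bool (\<eta> k = x))"
    unfolding N_def power2_eq_square sum_product ..
  also have "\<dots> = (\<Sum>i\<le>n. \<Sum>x\<in>?R. \<Sum>k\<le>n. of_bool (\<eta> i = x) * of_bool (\<eta> k = x))" by (rule sum.swap)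
  also have "\<dots> = (\<Sum>i\<le>n. \<Sum>k\<le>n. \<Sum>x\<in>?R. of_bool (\<eta> i = x) * of_bool (\<eta> k = x))"
    by (intro sum.cong refl sum.swap)
  also have "\<dots> = (\<Sum>i\<le>n. \<Sum>k\<le>n. of_bool (\<eta> i = \<eta> k))"
  proof (intro sum.cong refl)
    fix i k assume "i \<in> {..n}"
    have "(\<Sum>x\<in>?R. of_bool (\<eta> i = x) * of_bool (\<eta> k = x)) = (\<Sum>x\<in>?R. if \<eta> i = x then of_bool (\<eta> k = \<eta> i) else (0::real))"
      by (intro sum.cong refl) auto
    also have "\<dots> = of_bool (\<eta> i = \<eta> k)" using \<open>i \<in> {..n}\<close> by (simp add: eq_commute)
    finally show "(\<Sum>x\<in>?R. of_bool (\<eta> i = x) * of_bool (\<eta> k = x)) = (of_bool (\<eta> i = \<eta> k) :: real)" .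
  qed
  finally have 2: "(\<Sum>x\<in>?R. (N x)\<^sup>2) = (\<Sum>i\<le>n. \<Sum>k\<le>n. of_bool (\<eta> i = \<eta> k))" .
  have "0 \<le> (\<Sum>x\<in>?R. (1 - t * N x)\<^sup>2)" by (intro sum_nonneg) simp
  also have "\<dots> = (\<Sum>x\<in>?R. 1 - 2 * t * N x + t\<^sup>2 * (N x)\<^sup>2)"
    by (intro sum.cong refl) (simp add: power2_eq_square algebra_simps)
  also have "\<dots> = real (card ?R) - 2 * t * real (n+1) + t\<^sup>2 * (\<Sum>i\<le>n. \<Sum>k\<le>n. of_bool (\<eta> i = \<eta> k))"
    by (simp only: sum.distrib sum_subtractf sum_distrib_left[symmetric] 1 2) simp
  finally show ?thesis by simp
qed

lemma coincidences_le_returns: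
  fixes \<eta> :: "nat \<Rightarrow> 'a"
  shows "(\<Sum>i\<le>n. \<Sum>k\<le>n. of_bool (\<eta> i = \<eta> k) :: real) \<le> 2 * (\<Sum>i\<le>n. \<Sum>r\<le>n. of_bool (\<eta> (i + r) = \<eta> i))"
proof -
  let ?f = "\<lambda>i k. of_bool (\<eta> i = \<eta> k) :: real"
  have *: "(\<Sum>k\<le>n. of_bool (i \<le> k) * ?f i k) \<le> (\<Sum>r\<le>n. of_bool (\<eta> (i + r) = \<eta> i))" for i
  proof -
    have "(\<Sum>k\<le>n. of_bool (i \<le> k) * ?f i k) = (\<Sum>k\<in>{k\<in>{..n}. i \<le> k}. ?f i k)"
      by (subst sum.inter_filter) (simp, intro sum.cong refl, simp)
    also have "\<dots> = (\<Sum>r\<in>(\<lambda>k. k - i) ` {k\<in>{..n}. i \<le> k}. of_bool (\<eta> (i + r) = \<eta> i))"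
    proof (subst sum.reindex)
      show "inj_on (\<lambda>k. k - i) {k\<in>{..n}. i \<le> k}" by (auto intro!: inj_onI)
      show "(\<Sum>k\<in>{k\<in>{..n}. i \<le> k}. ?f i k) = sum ((\<lambda>r. of_bool (\<eta> (i + r) = \<eta> i)) \<circ> (\<lambda>k. k - i)) {k\<in>{..n}. i \<le> k}"
      proof (intro sum.cong refl)
        fix k assume "k \<in> {k\<in>{..n}. i \<le> k}"
        then have "\<eta> (i + (k - i)) = \<eta> k" by simp
        then show "?f i k = ((\<lambda>r. of_bool (\<eta> (i + r) = \<eta> i)) \<circ> (\<lambda>k. k - i)) k"
          unfolding o_apply by (simp only: eq_commute[of "\<eta> k" "\<eta> i"])
      qed
    qed
    also have "\<dots> \<le> (\<Sum>r\<le>n. of_bool (\<eta> (i + r) = \<eta> i))"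
      by (intro sum_mono2) auto
    finally show ?thesis .
  qed
  have "(\<Sum>i\<le>n. \<Sum>k\<le>n. ?f i k) \<le> (\<Sum>i\<le>n. \<Sum>k\<le>n. of_bool (i \<le> k) * ?f i k + of_bool (k \<le> i) * ?f k i)"
    by (intro sum_mono) auto
  also have "\<dots> = (\<Sum>i\<le>n. \<Sum>k\<le>n. of_bool (i \<le> k) * ?f i k) + (\<Sum>k\<le>n. \<Sum>i\<le>n. of_bool (k \<le> i) * ?f k i)"
    unfolding sum.distrib by (rule arg_cong2[where f="(+)", OF refl sum.swap])
  also have "\<dots> \<le> (\<Sum>i\<le>n. \<Sum>r\<le>n. of_bool (\<eta> (i + r) = \<eta> i)) + (\<Sum>i\<le>n. \<Sum>r\<le>n. of_bool (\<eta> (i + r) = \<eta> i))"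
    by (intro add_mono sum_mono *)
  finally show ?thesis by simp
qed

text \<open>A time \<open>k \<le> n - m\<close> is counted differently by the two sides only if the first return to \<open>\<eta> k\<close> occurs
  after more than \<open>m\<close> steps; the last \<open>m\<close> times account for the summand \<open>m\<close>.\<close>

lemma card_image_approx:
  fixes \<eta> :: "nat \<Rightarrow> 'a"
  shows "\<bar>real (card (\<eta> ` {..n})) - (\<Sum>k\<le>n. of_bool (\<forall>r\<in>{1..m}. \<eta> (k + r) \<noteq> \<eta> k))\<bar>
     \<le> real m + (\<Sum>k\<le>n. \<Sum>r\<in>{m<..n}. of_bool (\<eta> (k + r) = \<eta> k))"
proof -
  let ?J = "\<lambda>k. of_bool (\<forall>i\<in>{k<..n}. \<eta> i \<noteq> \<eta> k) :: real" and ?I = "\<lambda>k. of_bool (\<forall>r\<in>{1..m}. \<eta> (k + r) \<noteq> \<eta> k) :: real"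
  let ?R = "\<lambda>k. \<Sum>r\<in>{m<..n}. of_bool (\<eta> (k + r) = \<eta> k) :: real"
  have R0: "0 \<le> ?R k" for k by (intro sum_nonneg) simp
  have gen: "\<bar>a - b\<bar> \<le> d + e" if "\<bar>a - b\<bar> \<le> 1" "0 \<le> d" "0 \<le> e" "d = 1 \<or> a = b" for a b d e :: real
    using that by auto
  have one: "\<bar>?J k - ?I k\<bar> \<le> of_bool (n < k + m) + ?R k" for k
  proof (cases "n < k + m \<or> ?J k = ?I k")
    case True
    have "\<bar>?J k - ?I k\<bar> \<le> 1" by (simp split: split_of_bool)
    moreover have "of_bool (n < k + m) = (1::real) \<or> ?J k = ?I k" using True by (elim disjE) (simp_all only: of_bool_eq simp_thms)
    ultimately show ?thesis by (intro gen R0) simp_all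
  next
    case False
    then have km: "k + m \<le> n" and ne: "?J k \<noteq> ?I k" by auto
    have "?J k = 1 \<Longrightarrow> ?I k = 1" using km by auto
    with ne have I: "?I k = 1" and J: "?J k = 0" by (auto simp: of_bool_def split: if_splits)
    from J obtain i where i: "k < i" "i \<le> n" "\<eta> i = \<eta> k" by auto
    have "\<not> i - k \<le> m"
    proof
      assume "i - k \<le> m"
      then have "i - k \<in> {1..m}" using i by auto
      moreover have "\<forall>r\<in>{1..m}. \<eta> (k + r) \<noteq> \<eta> k" using I by (simp only: of_bool_eq_1_iff)
      ultimately have "\<eta> (k + (i - k)) \<noteq> \<eta> k" by blast
      then show False using i by simp
    qed
    then have "i - k \<in> {m<..n}" using i by auto
    then have "of_bool (\<eta> (k + (i - k)) = \<eta> k) \<le> ?R k" by (intro member_le_sum) auto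
    then have "1 \<le> ?R k" using i by simp
    then show ?thesis using I J by simp
  qed
  have "real (card (\<eta> ` {..n})) - (\<Sum>k\<le>n. ?I k) = (\<Sum>k\<le>n. ?J k - ?I k)"
    unfolding card_image_last_visits by (simp add: sum_subtractf)
  then have "\<bar>real (card (\<eta> ` {..n})) - (\<Sum>k\<le>n. ?I k)\<bar> \<le> (\<Sum>k\<le>n. \<bar>?J k - ?I k\<bar>)"
    by (simp only: sum_abs)
  also have "\<dots> \<le> (\<Sum>k\<le>n. of_bool (n < k + m) + ?R k)" by (intro sum_mono one)
  also have "\<dots> = real (card {k\<in>{..n}. n < k + m}) + (\<Sum>k\<le>n. ?R k)"
    by (simp add: sum.distrib of_bool_def sum.If_cases Int_def)
  also have "card {k\<in>{..n}. n < k + m} \<le> card {n+1-m..<n+1}" by (rule card_mono) auto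
  also have "\<dots> \<le> m" by simp
  finally show ?thesis by simp
qed

section \<open>Mean deviations\<close>

text \<open>Only the pairs of indices at distance less than \<open>m\<close> contribute to the second moment, and each
  index belongs to at most \<open>2 m + 1\<close> of them.\<close>

lemma (in prob_space) expectation_abs_sum_le:
  assumes [measurable]: "\<And>l. Z l \<in> borel_measurable M"
    and B: "\<And>l w. \<bar>Z l w\<bar> \<le> B"
    and orth: "\<And>k l. k + m \<le> l \<Longrightarrow> expectation (\<lambda>w. Z k w * Z l w) = 0"
  shows "expectation (\<lambda>w. \<bar>\<Sum>l\<le>n. Z l w\<bar>) \<le> B * sqrt (real (2*m+1)) * sqrt (real (n+1))"
proof -
  have B0: "0 \<le> B" using B[of 0 undefined] by linarith
  let ?S = "\<lambda>w. \<bar>\<Sum>l\<le>n. Z l w\<bar>"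
  have ZZ: "\<bar>Z k w * Z l w\<bar> \<le> B\<^sup>2" for k l w
    unfolding abs_mult power2_eq_square by (intro mult_mono B) (auto simp: B0)
  have iZZ: "integrable M (\<lambda>w. Z k w * Z l w)" for k l
    by (rule integrable_const_bound[where B="B\<^sup>2"]) (use ZZ in auto)
  have Sb: "?S w \<le> real (n+1) * B" for w
    using order_trans[OF sum_abs sum_mono[of "{..n}" "\<lambda>l. \<bar>Z l w\<bar>" "\<lambda>_. B"]] B by simp
  have iS: "integrable M ?S" by (rule integrable_const_bound[where B="real (n+1) * B"]) (use Sb in auto)
  have iS2: "integrable M (\<lambda>w. (?S w)\<^sup>2)"
    by (rule integrable_const_bound[where B="(real (n+1) * B)\<^sup>2"]) (use power_mono[OF Sb, where n=2] in auto)
  have sq: "(?S w)\<^sup>2 = (\<Sum>k\<le>n. \<Sum>l\<le>n. Z k w * Z l w)" for w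
    unfolding power2_abs by (simp only: power2_eq_square sum_product)
  have "(expectation ?S)\<^sup>2 \<le> expectation (\<lambda>w. (?S w)\<^sup>2)"
    using variance_eq[OF iS iS2] variance_positive[of ?S] by simp
  also have "expectation (\<lambda>w. (?S w)\<^sup>2) = (\<Sum>k\<le>n. \<Sum>l\<le>n. expectation (\<lambda>w. Z k w * Z l w))"
    unfolding sq by (simp add: iZZ)
  also have "\<dots> \<le> (\<Sum>k\<le>n. \<Sum>l\<le>n. if l < k + m \<and> k < l + m then B\<^sup>2 else 0)"
  proof (intro sum_mono)
    fix k l
    have "expectation (\<lambda>w. Z k w * Z l w) \<le> B\<^sup>2"
      using integral_mono[OF iZZ, of "\<lambda>_. B\<^sup>2" k l] ZZ by (simp add: abs_le_iff prob_space)
    moreover have "expectation (\<lambda>w. Z k w * Z l w) = 0" if "\<not> (l < k + m \<and> k < l + m)"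
      using that orth[of k l] orth[of l k] by (auto simp: not_less mult.commute)
    ultimately show "expectation (\<lambda>w. Z k w * Z l w) \<le> (if l < k + m \<and> k < l + m then B\<^sup>2 else 0)" by auto
  qed
  also have "\<dots> \<le> (\<Sum>k\<le>n. real (2*m+1) * B\<^sup>2)"
  proof (rule sum_mono)
    fix k
    have "(\<Sum>l\<le>n. if l < k + m \<and> k < l + m then B\<^sup>2 else 0) = real (card {l\<in>{..n}. l < k + m \<and> k < l + m}) * B\<^sup>2"
      by (subst sum.inter_filter[symmetric]) auto
    also have "card {l\<in>{..n}. l < k + m \<and> k < l + m} \<le> card {k-m..<k+m+1}"
      by (rule card_mono) auto
    also have "\<dots> \<le> 2*m+1" by simp
    finally show "(\<Sum>l\<le>n. if l < k + m \<and> k < l + m then B\<^sup>2 else 0) \<le> real (2*m+1) * B\<^sup>2"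
      by (simp add: mult_right_mono)
  qed
  also have "\<dots> = (B * sqrt (real (2*m+1)) * sqrt (real (n+1)))\<^sup>2"
    by (simp add: power_mult_distrib)
  finally show ?thesis by (rule power2_le_imp_le) (use B0 in simp)
qed

lemma (in prob_space) expectation_abs_centered_le:
  fixes X :: "'a \<Rightarrow> real"
  assumes "integrable M X"
  shows "expectation (\<lambda>w. \<bar>X w - expectation X\<bar>) \<le> 2 * expectation (\<lambda>w. \<bar>X w - a\<bar>)"
proof -
  have "\<bar>expectation X - a\<bar> = \<bar>expectation (\<lambda>w. X w - a)\<bar>" using assms by (simp add: prob_space)
  also have "\<dots> \<le> expectation (\<lambda>w. \<bar>X w - a\<bar>)" by (rule integral_abs_bound)
  finally have a: "\<bar>expectation X - a\<bar> \<le> expectation (\<lambda>w. \<bar>X w - a\<bar>)" .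
  have "expectation (\<lambda>w. \<bar>X w - expectation X\<bar>) \<le> expectation (\<lambda>w. \<bar>X w - a\<bar> + \<bar>expectation X - a\<bar>)"
    by (intro integral_mono) (use assms in auto)
  also have "\<dots> = expectation (\<lambda>w. \<bar>X w - a\<bar>) + \<bar>expectation X - a\<bar>"
    using assms by (simp add: prob_space)
  finally show ?thesis using a by simp
qed

section \<open>The number of steps without early return\<close>

locale rw_process = markov_process W \<xi> K + walk_kernel K
  for W :: "'w measure" and \<xi> :: "nat \<Rightarrow> 'w \<Rightarrow> (int ^ 'd) \<times> 'e::finite" and K
begin

text \<open>Several steps at once; the past that \<open>\<Phi>\<close> sees still ends at time \<open>i\<close>.\<close>

lemma markov_walk:
  fixes \<Phi> :: "((int ^ 'd) \<times> 'e) list \<Rightarrow> (int ^ 'd) \<times> 'e \<Rightarrow> real"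
  assumes B: "\<And>xs b. \<bar>\<Phi> xs b\<bar> \<le> B"
  shows "expectation (\<lambda>w. \<Phi> (past i w) (\<xi> (i + n) w)) = expectation (\<lambda>w. measure_pmf.expectation (walk n (\<xi> i w)) (\<Phi> (past i w)))"
  using B
proof (induction n arbitrary: \<Phi>)
  case (Suc n)
  have B: "\<bar>\<Phi> xs b\<bar> \<le> B" for xs b by (rule Suc.prems)
  have "expectation (\<lambda>w. \<Phi> (past i w) (\<xi> (i + Suc n) w)) = expectation (\<lambda>w. \<Phi> (take (Suc i) (past (i + n) w)) (\<xi> (Suc (i + n)) w))"
    by (simp add: take_past)
  also have "\<dots> = expectation (\<lambda>w. measure_pmf.expectation (K (\<xi> (i + n) w)) (\<Phi> (take (Suc i) (past (i + n) w))))"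
    by (rule markov) (rule B)
  also have "\<dots> = expectation (\<lambda>w. measure_pmf.expectation (K (\<xi> (i + n) w)) (\<Phi> (past i w)))"
    by (simp add: take_past)
  also have "\<dots> = expectation (\<lambda>w. measure_pmf.expectation (walk n (\<xi> i w)) (\<lambda>c. measure_pmf.expectation (K c) (\<Phi> (past i w))))"
    by (rule Suc.IH[of "\<lambda>xs c. measure_pmf.expectation (K c) (\<Phi> xs)"]) (intro abs_expectation_pmf_le B)
  also have "\<dots> = expectation (\<lambda>w. measure_pmf.expectation (walk (Suc n) (\<xi> i w)) (\<Phi> (past i w)))"
    by (simp add: integral_pmf_bind[where B=B] B)
  finally show ?case .
qed simp

lemma measurable_of_past:
  fixes f :: "'w \<Rightarrow> real"
  assumes "\<And>w. f w = F (past n w)"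
  shows "f \<in> borel_measurable W"
proof -
  have "f = (\<lambda>w. F (past n w))" using assms by auto
  then show ?thesis by simp
qed

lemma integrable_of_past:
  assumes "\<And>w. f w = F (past n w)" "\<And>w. \<bar>f w\<bar> \<le> B"
  shows "integrable W (f :: 'w \<Rightarrow> real)"
  by (rule integrable_const_bound[where B=B]) (use assms(2) measurable_of_past[of f F n, OF assms(1)] in auto)

lemma integrable_return: "integrable W (\<lambda>w. of_bool (fst (\<xi> (i + n) w) = fst (\<xi> i w)) :: real)"
  by (rule integrable_of_past[where F="\<lambda>xs. of_bool (fst (xs ! (i + n)) = fst (xs ! i))" and n="i+n" and B=1])
     (auto simp: nth_past)

lemma integrable_inner: "integrable W (\<lambda>w. g (snd (\<xi> i w)) :: real)"
proof (rule integrable_of_past[where F="\<lambda>xs. g (snd (xs ! i))" and n=i and B="Max (range (\<lambda>j. \<bar>g j\<bar>))"])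
  show "\<bar>g (snd (\<xi> i w))\<bar> \<le> Max (range (\<lambda>j. \<bar>g j\<bar>))" for w by (rule Max_ge) auto
qed (simp add: nth_past)

lemma expectation_return: "expectation (\<lambda>w. of_bool (fst (\<xi> (i + n) w) = fst (\<xi> i w))) = expectation (\<lambda>w. hit n (snd (\<xi> i w)) 0)"
proof -
  have "expectation (\<lambda>w. of_bool (fst (\<xi> (i + n) w) = fst (\<xi> i w)) :: real)
      = expectation (\<lambda>w. (\<lambda>xs b. of_bool (fst b = fst (last xs))) (past i w) (\<xi> (i + n) w))" by simp
  also have "\<dots> = expectation (\<lambda>w. measure_pmf.expectation (walk n (\<xi> i w)) (\<lambda>b. of_bool (fst b = fst (last (past i w)))))"
    by (rule markov_walk[of "\<lambda>xs b. of_bool (fst b = fst (last xs))" 1]) simp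
  also have "(\<lambda>w. measure_pmf.expectation (walk n (\<xi> i w)) (\<lambda>b. of_bool (fst b = fst (last (past i w))))) = (\<lambda>w. hit n (snd (\<xi> i w)) 0)"
  proof
    fix w
    have eq: "(\<lambda>b. of_bool (fst b = fst (\<xi> i w)) :: real) = indicator {b. fst b = fst (\<xi> i w)}" by (auto simp: indicator_def)
    show "measure_pmf.expectation (walk n (\<xi> i w)) (\<lambda>b. of_bool (fst b = fst (last (past i w)))) = hit n (snd (\<xi> i w)) 0"
      unfolding last_past eq using hit_from[of n "\<xi> i w" "fst (\<xi> i w)"] by simp
  qed
  finally show ?thesis .
qed

lemma expected_returns_le:
  assumes "finite R" "\<And>j. (\<Sum>r\<in>R. hit r j 0) \<le> C"
  shows "expectation (\<lambda>w. \<Sum>r\<in>R. of_bool (fst (\<xi> (i + r) w) = fst (\<xi> i w))) \<le> C"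
proof -
  have i: "integrable W (\<lambda>w. hit r (snd (\<xi> i w)) 0)" for r by (rule integrable_inner)
  have "expectation (\<lambda>w. \<Sum>r\<in>R. of_bool (fst (\<xi> (i + r) w) = fst (\<xi> i w))) = expectation (\<lambda>w. \<Sum>r\<in>R. hit r (snd (\<xi> i w)) 0)"
    by (simp add: integrable_return i expectation_return)
  also have "\<dots> \<le> expectation (\<lambda>w. C)"
    by (intro integral_mono Bochner_Integration.integrable_sum i) (use assms in auto)
  finally show ?thesis by (simp add: prob_space)
qed

text \<open>The probability that the walk from \<open>b\<close> avoids the site \<open>x\<close> at the times \<open>1, ..., m\<close>.\<close>

primrec avoid :: "nat \<Rightarrow> int ^ 'd \<Rightarrow> (int ^ 'd) \<times> 'e \<Rightarrow> real" where
  "avoid 0 x b = 1"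
| "avoid (Suc m) x b = measure_pmf.expectation (K b) (\<lambda>b'. of_bool (fst b' \<noteq> x) * avoid m x b')"

lemma avoid_bounds: "0 \<le> avoid m x b" "avoid m x b \<le> 1"
proof (induction m arbitrary: b)
  case (Suc m)
  { case 1 show ?case using Suc by (auto intro!: Bochner_Integration.integral_nonneg) }
  { case 2
    have "\<bar>of_bool (fst b' \<noteq> x) * avoid m x b'\<bar> \<le> 1" for b' using Suc[of b'] by (auto simp: abs_mult)
    from abs_expectation_pmf_le[OF this, of "K b"] show ?case by (simp add: abs_le_iff) }
qed auto

lemma avoid_shift: "avoid m (u + x) (u + y, j) = avoid m x (y, j)"
  by (induction m arbitrary: y j) (simp_all add: shift apfst_def map_prod_def case_prod_beta)

lemma avoid_start: "avoid m (fst b) b = avoid m 0 (0, snd b)"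
  using avoid_shift[of m "fst b" 0 0 "snd b"] by simp

text \<open>The avoided site \<open>X\<close> may depend on the past, in order that it can be the site occupied at time
  \<open>l\<close>. The induction moves the time \<open>l\<close> forward and keeps the site, so the statement has to hold for
  any \<open>G\<close> and \<open>X\<close>.\<close>

lemma markov_avoid:
  assumes "\<And>xs. \<bar>G xs\<bar> \<le> B"
  shows "expectation (\<lambda>w. G (past l w) * of_bool (\<forall>r\<in>{1..m}. fst (\<xi> (l + r) w) \<noteq> X (past l w)))
    = expectation (\<lambda>w. G (past l w) * avoid m (X (past l w)) (\<xi> l w))"
  using assms
proof (induction m arbitrary: l G X)
  case (Suc m)
  have B: "\<bar>G xs\<bar> \<le> B" for xs by (rule Suc.prems)
  have split: "(\<forall>r\<in>{1..Suc m}. P (l + r)) \<longleftrightarrow> P (Suc l) \<and> (\<forall>r\<in>{1..m}. P (Suc l + r))" for P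
  proof -
    have e: "{1..Suc m} = insert 1 (Suc ` {1..m})" by (subst image_Suc_atLeastAtMost) auto
    show ?thesis unfolding e by (simp del: image_Suc_atLeastAtMost)
  qed
  have split: "(\<forall>r\<in>{1..Suc m}. fst (\<xi> (l + r) w) \<noteq> y) \<longleftrightarrow> fst (\<xi> (Suc l) w) \<noteq> y \<and> (\<forall>r\<in>{1..m}. fst (\<xi> (Suc l + r) w) \<noteq> y)" for w y
    by (rule split[of "\<lambda>i. fst (\<xi> i w) \<noteq> y"])
  (* the first avoided step becomes part of the factor that depends on the past *)
  let ?G = "\<lambda>xs. G (take (Suc l) xs) * of_bool (fst (last xs) \<noteq> X (take (Suc l) xs))"
  have G: "\<bar>?G xs\<bar> \<le> B" for xs using B[of "take (Suc l) xs"] by auto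
  have "expectation (\<lambda>w. G (past l w) * of_bool (\<forall>r\<in>{1..Suc m}. fst (\<xi> (l + r) w) \<noteq> X (past l w)))
    = expectation (\<lambda>w. ?G (past (Suc l) w) * of_bool (\<forall>r\<in>{1..m}. fst (\<xi> (Suc l + r) w) \<noteq> X (take (Suc l) (past (Suc l) w))))"
    unfolding split by (simp only: take_past[of l "Suc l"] le_SucI order_refl last_past of_bool_conj mult.assoc)
  also have "\<dots> = expectation (\<lambda>w. ?G (past (Suc l) w) * avoid m (X (take (Suc l) (past (Suc l) w))) (\<xi> (Suc l) w))"
    by (rule Suc.IH) (rule G)
  also have "\<dots> = expectation (\<lambda>w. (\<lambda>xs b. G xs * (of_bool (fst b \<noteq> X xs) * avoid m (X xs) b)) (past l w) (\<xi> (Suc l) w))"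
    by (simp add: take_past mult.assoc)
  also have "\<dots> = expectation (\<lambda>w. measure_pmf.expectation (K (\<xi> l w)) (\<lambda>b. G (past l w) * (of_bool (fst b \<noteq> X (past l w)) * avoid m (X (past l w)) b)))"
  proof (rule markov)
    show "\<bar>G xs * (of_bool (fst b \<noteq> X xs) * avoid m (X xs) b)\<bar> \<le> B" for xs b
    proof -
      have "\<bar>G xs\<bar> * (of_bool (fst b \<noteq> X xs) * avoid m (X xs) b) \<le> B * 1"
        by (intro mult_mono B) (use avoid_bounds[of m "X xs" b] B[of xs] in auto)
      then show ?thesis by (simp add: abs_mult avoid_bounds)
    qed
  qed
  finally show ?case by simp
qed simp

text \<open>With \<open>h j\<close> the probability of no return within \<open>m\<close> steps from internal state \<open>j\<close>, and \<open>v\<close>, \<open>c\<close> from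
  the Poisson equation for \<open>h\<close>, split the indicator at time \<open>l\<close> minus \<open>c\<close> into three parts: the
  difference \<open>Z l\<close> between the indicator and its conditional expectation, the martingale difference
  \<open>Y l\<close> of \<open>v\<close> along the internal states, and a telescoping term.\<close>

lemma no_return_deviation:
  assumes irr: "irreducible_mat inner_matrix" and stat: "stationary_distribution inner_matrix \<mu>"
  shows "\<exists>c C. \<forall>n. expectation (\<lambda>w. \<bar>(\<Sum>l\<le>n. of_bool (\<forall>r\<in>{1..m}. fst (\<xi> (l + r) w) \<noteq> fst (\<xi> l w))) - real (n+1) * c\<bar>) \<le> C * sqrt (real (n+1))"
proof -
  define h where "h j = avoid m 0 (0, j)" for j
  have h01: "0 \<le> h j" "h j \<le> 1" for j unfolding h_def by (rule avoid_bounds)+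
  obtain v c where vc: "\<And>j. h j = c + v $ j - (inner_matrix *v v) $ j"
    using poisson_equation[OF inner_matrix_stochastic irr stat, of "vec_lambda h"] by auto
  define V where "V = Max (range (\<lambda>j. \<bar>v $ j\<bar>))"
  have V: "\<bar>v $ j\<bar> \<le> V" for j unfolding V_def by (rule Max_ge) auto
  have QV: "\<bar>(inner_matrix *v v) $ j\<bar> \<le> V" for j
    using abs_expectation_pmf_le[of "\<lambda>b. v $ snd b" V "K (0, j)"] V expectation_inner_state[of "(0, j)" "\<lambda>k. v $ k"] by simp
  define I where "I l w = (of_bool (\<forall>r\<in>{1..m}. fst (\<xi> (l + r) w) \<noteq> fst (\<xi> l w)) :: real)" for l w
  define Z where "Z l w = I l w - h (snd (\<xi> l w))" for l w
  define Y where "Y l w = v $ snd (\<xi> (Suc l) w) - (inner_matrix *v v) $ snd (\<xi> l w)" for l w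
  (* the same variables as functions of the past *)
  define IF where "IF l xs = (of_bool (\<forall>r\<in>{1..m}. fst (xs ! (l + r)) \<noteq> fst (xs ! l)) :: real)" for l and xs :: "((int ^ 'd) \<times> 'e) list"
  define ZF where "ZF l xs = IF l xs - h (snd (xs ! l))" for l and xs :: "((int ^ 'd) \<times> 'e) list"
  define YF where "YF l xs = v $ snd (xs ! Suc l) - (inner_matrix *v v) $ snd (xs ! l)" for l and xs :: "((int ^ 'd) \<times> 'e) list"
  have ZF: "Z k w = ZF k (past l w)" if "k + m \<le> l" for k l w
    using that by (simp add: Z_def ZF_def I_def IF_def nth_past)
  have YF: "Y k w = YF k (past l w)" if "k + 1 \<le> l" for k l w
    using that by (simp add: Y_def YF_def nth_past)
  have ZFb: "\<bar>ZF l xs\<bar> \<le> 1" for l xs using h01[of "snd (xs ! l)"] by (simp add: ZF_def IF_def)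
  have YFb: "\<bar>YF l xs\<bar> \<le> 2 * V" for l xs using V[of "snd (xs ! Suc l)"] QV[of "snd (xs ! l)"] by (simp add: YF_def)
  (* Z k is determined by the past up to k + m, and Z l has mean 0 given the past up to l *)
  have Z1: "expectation (\<lambda>w. \<bar>\<Sum>l\<le>n. Z l w\<bar>) \<le> 1 * sqrt (real (2*m+1)) * sqrt (real (n+1))" for n
  proof (rule expectation_abs_sum_le)
    show "Z l \<in> borel_measurable W" for l by (rule measurable_of_past[of _ "ZF l" "l+m"]) (simp add: ZF)
    show "\<bar>Z l w\<bar> \<le> 1" for l w using ZFb ZF[of l "l+m"] by simp
    fix k l assume kl: "k + m \<le> l"
    have "expectation (\<lambda>w. ZF k (past l w) * I l w) = expectation (\<lambda>w. ZF k (past l w) * h (snd (\<xi> l w)))"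
      using markov_avoid[of "ZF k" 1 l m "\<lambda>xs. fst (last xs)"] ZFb by (simp add: I_def h_def avoid_start)
    moreover have "integrable W (\<lambda>w. ZF k (past l w) * I l w)"
      by (rule integrable_of_past[where F="\<lambda>xs. ZF k (take (Suc l) xs) * IF l xs" and n="l+m" and B=1])
         (use ZFb in \<open>auto simp: take_past I_def IF_def nth_past\<close>)
    moreover have "integrable W (\<lambda>w. ZF k (past l w) * h (snd (\<xi> l w)))"
      by (rule integrable_of_past[where F="\<lambda>xs. ZF k xs * h (snd (last xs))" and n=l and B=1])
         (use mult_mono[OF ZFb h01(2)] h01 in \<open>auto simp: abs_mult\<close>)
    ultimately show "expectation (\<lambda>w. Z k w * Z l w) = 0"
      by (simp add: ZF[OF kl] Z_def[of l] right_diff_distrib)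
  qed
  have Y1: "expectation (\<lambda>w. \<bar>\<Sum>l\<le>n. Y l w\<bar>) \<le> 2 * V * sqrt (real (2*1+1)) * sqrt (real (n+1))" for n
  proof (rule expectation_abs_sum_le)
    show "Y l \<in> borel_measurable W" for l by (rule measurable_of_past[of _ "YF l" "l+1"]) (simp add: YF)
    show "\<bar>Y l w\<bar> \<le> 2 * V" for l w using YFb YF[of l "l+1"] by simp
    fix k l :: nat assume kl: "k + 1 \<le> l"
    let ?Qv = "\<lambda>w. (inner_matrix *v v) $ snd (\<xi> l w)"
    have V0: "0 \<le> V" using order_trans[OF abs_ge_zero V] .
    have "expectation (\<lambda>w. YF k (past l w) * v $ snd (\<xi> (Suc l) w)) = expectation (\<lambda>w. measure_pmf.expectation (K (\<xi> l w)) (\<lambda>b. YF k (past l w) * v $ snd b))"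
      by (rule markov[of "\<lambda>xs b. YF k xs * v $ snd b" "2 * V * V"]) (auto simp: abs_mult intro!: mult_mono V order_trans[OF _ YFb] V0)
    also have "\<dots> = expectation (\<lambda>w. YF k (past l w) * ?Qv w)"
      using expectation_inner_state[where g="\<lambda>k. v $ k"] by simp
    finally have "expectation (\<lambda>w. YF k (past l w) * v $ snd (\<xi> (Suc l) w)) = expectation (\<lambda>w. YF k (past l w) * ?Qv w)" .
    moreover have "integrable W (\<lambda>w. YF k (past l w) * v $ snd (\<xi> (Suc l) w))"
      by (rule integrable_of_past[where F="\<lambda>xs. YF k (take (Suc l) xs) * v $ snd (last xs)" and n="Suc l" and B="2 * V * V"])
         (auto simp: take_past abs_mult intro!: mult_mono V order_trans[OF _ YFb] V0)
    moreover have "integrable W (\<lambda>w. YF k (past l w) * ?Qv w)"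
      by (rule integrable_of_past[where F="\<lambda>xs. YF k xs * (inner_matrix *v v) $ snd (last xs)" and n=l and B="2 * V * V"])
         (auto simp: abs_mult intro!: mult_mono QV order_trans[OF _ YFb] V0)
    ultimately show "expectation (\<lambda>w. Y k w * Y l w) = 0"
      by (simp add: YF[OF kl] Y_def[of l] right_diff_distrib)
  qed
  have decomp: "(\<Sum>l\<le>n. I l w) - real (n+1) * c = (\<Sum>l\<le>n. Z l w) + (\<Sum>l\<le>n. Y l w) + (v $ snd (\<xi> 0 w) - v $ snd (\<xi> (Suc n) w))" for n w
    by (induction n) (auto simp: Z_def Y_def vc algebra_simps)
  have "expectation (\<lambda>w. \<bar>(\<Sum>l\<le>n. I l w) - real (n+1) * c\<bar>) \<le> (sqrt (real (2*m+1)) + 2 * V * sqrt 3 + 2 * V) * sqrt (real (n+1))" for n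
  proof -
    have V0: "0 \<le> V" using order_trans[OF abs_ge_zero V] .
    have "integrable W (Z l)" for l
      by (rule integrable_of_past[where F="ZF l" and n="l+m" and B=1]) (simp_all add: ZF[of l "l+m"] ZFb)
    then have iZ: "integrable W (\<lambda>w. \<bar>\<Sum>l\<le>n. Z l w\<bar>)"
      by (intro integrable_abs Bochner_Integration.integrable_sum)
    have "integrable W (Y l)" for l
      by (rule integrable_of_past[where F="YF l" and n="l+1" and B="2*V"]) (simp_all only: YF[of l "l+1"] YFb order_refl)
    then have iY: "integrable W (\<lambda>w. \<bar>\<Sum>l\<le>n. Y l w\<bar>)"
      by (intro integrable_abs Bochner_Integration.integrable_sum)
    have "integrable W (I l)" for l
      by (rule integrable_of_past[where F="IF l" and n="l+m" and B=1]) (simp_all add: I_def IF_def nth_past)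
    then have iI: "integrable W (\<lambda>w. \<bar>(\<Sum>l\<le>n. I l w) - real (n+1) * c\<bar>)"
      by (intro integrable_abs Bochner_Integration.integrable_sum Bochner_Integration.integrable_diff) simp_all
    have "expectation (\<lambda>w. \<bar>(\<Sum>l\<le>n. I l w) - real (n+1) * c\<bar>) \<le> expectation (\<lambda>w. \<bar>\<Sum>l\<le>n. Z l w\<bar> + \<bar>\<Sum>l\<le>n. Y l w\<bar> + 2 * V)"
    proof (intro integral_mono iI Bochner_Integration.integrable_add iZ iY)
      fix w show "\<bar>(\<Sum>l\<le>n. I l w) - real (n+1) * c\<bar> \<le> \<bar>\<Sum>l\<le>n. Z l w\<bar> + \<bar>\<Sum>l\<le>n. Y l w\<bar> + 2 * V"
        unfolding decomp using V[of "snd (\<xi> 0 w)"] V[of "snd (\<xi> (Suc n) w)"] by linarith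
    qed simp
    also have "\<dots> = expectation (\<lambda>w. \<bar>\<Sum>l\<le>n. Z l w\<bar>) + expectation (\<lambda>w. \<bar>\<Sum>l\<le>n. Y l w\<bar>) + 2 * V"
      by (simp add: iZ iY prob_space)
    also have "\<dots> \<le> sqrt (real (2*m+1)) * sqrt (real (n+1)) + 2 * V * sqrt 3 * sqrt (real (n+1)) + 2 * V * sqrt (real (n+1))"
    proof (intro add_mono)
      have "1 * (2 * V) \<le> sqrt (real (n+1)) * (2 * V)" using V0 by (intro mult_right_mono) auto
      then show "2 * V \<le> 2 * V * sqrt (real (n+1))" by (simp add: mult.commute)
    qed (use Z1[of n] Y1[of n] in simp_all)
    finally show ?thesis by (simp add: algebra_simps)
  qed
  then show ?thesis unfolding I_def by blast
qed

end

section \<open>The weak law of large numbers\<close>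

context rw_process
begin

lemma integrable_sites: "integrable W (\<lambda>w. real (sites_visited \<xi> n w))"
proof (rule integrable_of_past[where F="\<lambda>xs. real (card ((\<lambda>i. fst (xs ! i)) ` {..n}))" and n=n and B="real (n+1)"])
  fix w
  have "(\<lambda>i. fst (past n w ! i)) ` {..n} = (\<lambda>i. fst (\<xi> i w)) ` {..n}" by (auto simp: nth_past)
  then show "real (sites_visited \<xi> n w) = real (card ((\<lambda>i. fst (past n w ! i)) ` {..n}))"
    by (simp add: sites_visited_def)
  have "sites_visited \<xi> n w \<le> card {..n}" unfolding sites_visited_def by (rule card_image_le) simp
  then show "\<bar>real (sites_visited \<xi> n w)\<bar> \<le> real (n+1)" by simp
qed

text \<open>From any time on, that time included, the current site is occupied at most \<open>\<Gamma>\<close> times in the mean, so there are at most \<open>2 (n + 1) \<Gamma>\<close>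
  coincidences in the mean.\<close>

lemma expected_sites_ge:
  assumes \<Gamma>: "\<And>M i x. visits M i x \<le> \<Gamma>" "0 < \<Gamma>"
  shows "real (n+1) / (2 * \<Gamma>) \<le> expected_sites W \<xi> n"
proof -
  let ?ret = "\<lambda>i w. \<Sum>r\<le>n. of_bool (fst (\<xi> (i + r) w) = fst (\<xi> i w)) :: real"
  (* the value of t that maximises 2 t (n + 1) - 2 t^2 (n + 1) \<Gamma> *)
  define t where "t = 1 / (2 * \<Gamma>)"
  have iret: "integrable W (?ret i)" for i by (intro Bochner_Integration.integrable_sum integrable_return)
  have ret: "expectation (?ret i) \<le> \<Gamma>" for i
  proof (rule expected_returns_le)
    show "(\<Sum>r\<le>n. hit r j 0) \<le> \<Gamma>" for j
      using \<Gamma>(1)[of "Suc n" j 0] by (simp add: visits_def lessThan_Suc_atMost)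
  qed simp
  have lin: "expectation (\<lambda>w. a - b * (2 * (\<Sum>i\<le>n. f i w))) = a - b * (2 * (\<Sum>i\<le>n. expectation (f i)))"
    if "\<And>i. integrable W (f i)" for f :: "nat \<Rightarrow> 'w \<Rightarrow> real" and a b
    using that by (simp add: prob_space)
  have "2 * t * real (n+1) - t\<^sup>2 * (2 * (real (n+1) * \<Gamma>)) \<le> 2 * t * real (n+1) - t\<^sup>2 * (2 * (\<Sum>i\<le>n. expectation (?ret i)))"
    using sum_mono[of "{..n}" "\<lambda>i. expectation (?ret i)" "\<lambda>_. \<Gamma>"] ret
    by (intro diff_left_mono mult_left_mono) auto
  also have "\<dots> = expectation (\<lambda>w. 2 * t * real (n+1) - t\<^sup>2 * (2 * (\<Sum>i\<le>n. ?ret i w)))"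
    by (rule lin[OF iret, symmetric])
  also have "\<dots> \<le> expectation (\<lambda>w. real (sites_visited \<xi> n w))"
  proof (intro integral_mono integrable_sites)
    show "integrable W (\<lambda>w. 2 * t * real (n+1) - t\<^sup>2 * (2 * (\<Sum>i\<le>n. ?ret i w)))"
      by (intro Bochner_Integration.integrable_diff integrable_mult_right Bochner_Integration.integrable_sum iret integrable_const)
    fix w
    have "t\<^sup>2 * (\<Sum>i\<le>n. \<Sum>k\<le>n. of_bool (fst (\<xi> i w) = fst (\<xi> k w))) \<le> t\<^sup>2 * (2 * (\<Sum>i\<le>n. ?ret i w))"
      by (intro mult_left_mono coincidences_le_returns[of "\<lambda>i. fst (\<xi> i w)"]) simp
    then show "2 * t * real (n+1) - t\<^sup>2 * (2 * (\<Sum>i\<le>n. ?ret i w)) \<le> real (sites_visited \<xi> n w)"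
      using card_image_ge[of t n "\<lambda>i. fst (\<xi> i w)"] unfolding sites_visited_def by linarith
  qed
  also have "2 * t * real (n+1) - t\<^sup>2 * (2 * (real (n+1) * \<Gamma>)) = real (n+1) / (2 * \<Gamma>)"
    using \<Gamma>(2) by (simp add: t_def power2_eq_square field_simps)
  finally show ?thesis by (simp add: expected_sites_def)
qed

text \<open>The return probabilities are summable for each of the finitely many internal states.\<close>

lemma uniform_return_tail:
  assumes \<Gamma>: "\<And>M i x. visits M i x \<le> \<Gamma>" and e: "0 < e"
  shows "\<exists>m. \<forall>n j. (\<Sum>r\<in>{m<..n}. hit r j 0) \<le> e"
proof -
  have "\<exists>N. \<forall>m\<ge>N. \<forall>n. norm (\<Sum>r\<in>{m..<n}. hit r j 0) < e" for j
  proof -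
    have "summable (\<lambda>r. hit r j 0)"
      by (rule summableI_nonneg_bounded[where x=\<Gamma>]) (use \<Gamma> hit_bounds in \<open>auto simp: visits_def\<close>)
    then show ?thesis unfolding summable_Cauchy using e by blast
  qed
  then obtain N where N: "\<And>j m n. N j \<le> m \<Longrightarrow> norm (\<Sum>r\<in>{m..<n}. hit r j 0) < e" by metis
  have "(\<Sum>r\<in>{Max (range N)<..n}. hit r j 0) \<le> e" for n j
  proof -
    have "N j \<le> Max (range N)" by simp
    then have "N j \<le> Suc (Max (range N))" by (rule le_SucI)
    from N[OF this, of "Suc n"] show ?thesis
      by (simp add: atLeastSucLessThan_greaterThanLessThan atLeastSucAtMost_greaterThanAtMost[symmetric] atLeastLessThanSuc_atLeastAtMost)
  qed
  then show ?thesis by blast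
qed

lemma sites_deviation:
  assumes \<Gamma>: "\<And>M i x. visits M i x \<le> \<Gamma>"
    and irr: "irreducible_mat inner_matrix" and stat: "stationary_distribution inner_matrix \<mu>" and e: "0 < e"
  shows "\<exists>m C. \<forall>n. expectation (\<lambda>w. \<bar>real (sites_visited \<xi> n w) - expected_sites W \<xi> n\<bar>)
     \<le> 2 * (real (n+1) * e + real m + C * sqrt (real (n+1)))"
proof -
  obtain m where m: "\<And>n j. (\<Sum>r\<in>{m<..n}. hit r j 0) \<le> e" using uniform_return_tail[OF \<Gamma> e] by blast
  let ?S = "\<lambda>n w. \<Sum>l\<le>n. of_bool (\<forall>r\<in>{1..m}. fst (\<xi> (l + r) w) \<noteq> fst (\<xi> l w)) :: real"
  let ?ret = "\<lambda>n k w. \<Sum>r\<in>{m<..n}. of_bool (fst (\<xi> (k + r) w) = fst (\<xi> k w)) :: real"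
  obtain c C where C: "\<And>n. expectation (\<lambda>w. \<bar>?S n w - real (n+1) * c\<bar>) \<le> C * sqrt (real (n+1))"
    using no_return_deviation[OF irr stat, of m] by blast
  have "expectation (\<lambda>w. \<bar>real (sites_visited \<xi> n w) - expected_sites W \<xi> n\<bar>)
     \<le> 2 * (real (n+1) * e + real m + C * sqrt (real (n+1)))" for n
  proof -
    let ?L = "\<lambda>w. real (sites_visited \<xi> n w)"
    have "integrable W (\<lambda>w. of_bool (\<forall>r\<in>{1..m}. fst (\<xi> (l + r) w) \<noteq> fst (\<xi> l w)) :: real)" for l
      by (rule integrable_of_past[where F="\<lambda>xs. of_bool (\<forall>r\<in>{1..m}. fst (xs ! (l + r)) \<noteq> fst (xs ! l))" and n="l+m" and B=1])
         (simp_all add: nth_past)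
    then have iS: "integrable W (\<lambda>w. \<bar>?S n w - real (n+1) * c\<bar>)"
      by (intro integrable_abs Bochner_Integration.integrable_diff Bochner_Integration.integrable_sum integrable_const)
    have iret: "integrable W (?ret n k)" for k by (intro Bochner_Integration.integrable_sum integrable_return)
    have ret: "expectation (?ret n k) \<le> e" for k by (rule expected_returns_le) (simp_all add: m)
    have lin: "expectation (\<lambda>w. (a + (\<Sum>k\<le>n. f k w)) + g w) = (a + (\<Sum>k\<le>n. expectation (f k))) + expectation g"
      if "\<And>k. integrable W (f k)" "integrable W g" for f :: "nat \<Rightarrow> 'w \<Rightarrow> real" and g a
      using that by (simp add: prob_space)
    have "expectation (\<lambda>w. \<bar>?L w - expected_sites W \<xi> n\<bar>) \<le> 2 * expectation (\<lambda>w. \<bar>?L w - real (n+1) * c\<bar>)"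
      unfolding expected_sites_def by (rule expectation_abs_centered_le[OF integrable_sites])
    also have "expectation (\<lambda>w. \<bar>?L w - real (n+1) * c\<bar>)
        \<le> expectation (\<lambda>w. (real m + (\<Sum>k\<le>n. ?ret n k w)) + \<bar>?S n w - real (n+1) * c\<bar>)"
    proof (intro integral_mono Bochner_Integration.integrable_add iS Bochner_Integration.integrable_sum integrable_return integrable_const)
      show "integrable W (\<lambda>w. \<bar>?L w - real (n+1) * c\<bar>)"
        by (intro integrable_abs Bochner_Integration.integrable_diff integrable_sites integrable_const)
      fix w
      show "\<bar>?L w - real (n+1) * c\<bar> \<le> (real m + (\<Sum>k\<le>n. ?ret n k w)) + \<bar>?S n w - real (n+1) * c\<bar>"
        using card_image_approx[of "\<lambda>i. fst (\<xi> i w)" n m] unfolding sites_visited_def by linarith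
    qed
    also have "\<dots> = (real m + (\<Sum>k\<le>n. expectation (?ret n k))) + expectation (\<lambda>w. \<bar>?S n w - real (n+1) * c\<bar>)"
      by (rule lin[OF iret iS])
    also have "\<dots> \<le> (real m + (\<Sum>k\<le>n. e)) + C * sqrt (real (n+1))"
      by (intro add_mono sum_mono ret C order_refl)
    finally show ?thesis by (simp add: algebra_simps)
  qed
  then show ?thesis by blast
qed

theorem weak_law_sites:
  assumes \<Gamma>: "\<And>M i x. visits M i x \<le> \<Gamma>" "0 < \<Gamma>"
    and irr: "irreducible_mat inner_matrix" and stat: "stationary_distribution inner_matrix \<mu>"
    and \<epsilon>: "0 < \<epsilon>"
  shows "(\<lambda>n. \<P>(w in W. \<bar>real (sites_visited \<xi> n w) - expected_sites W \<xi> n\<bar> > \<epsilon> * expected_sites W \<xi> n)) \<longlonglongrightarrow> 0"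
proof (rule LIMSEQ_I)
  fix \<delta> :: real assume \<delta>: "0 < \<delta>"
  (* chosen such that the part of the bound that does not vanish in the limit is \<delta> / 2 *)
  define e where "e = \<epsilon> * \<delta> / (8 * \<Gamma>)"
  have e: "0 < e" using \<delta> \<epsilon> \<Gamma>(2) by (simp add: e_def)
  obtain m C where dev: "\<And>n. expectation (\<lambda>w. \<bar>real (sites_visited \<xi> n w) - expected_sites W \<xi> n\<bar>)
     \<le> 2 * (real (n+1) * e + real m + C * sqrt (real (n+1)))"
    using sites_deviation[OF \<Gamma>(1) irr stat e] by blast
  let ?P = "\<lambda>n. \<P>(w in W. \<bar>real (sites_visited \<xi> n w) - expected_sites W \<xi> n\<bar> > \<epsilon> * expected_sites W \<xi> n)"
  let ?r = "\<lambda>n. (4 * \<Gamma> / \<epsilon>) * (real m / real (n+1) + C / sqrt (real (n+1)))"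
  have bound: "?P n \<le> \<delta> / 2 + ?r n" for n
  proof -
    let ?X = "\<lambda>w. \<bar>real (sites_visited \<xi> n w) - expected_sites W \<xi> n\<bar>"
    let ?a = "\<epsilon> * (real (n+1) / (2 * \<Gamma>))"
    have a: "0 < ?a" using \<epsilon> \<Gamma>(2) by simp
    have aE: "?a \<le> \<epsilon> * expected_sites W \<xi> n" using expected_sites_ge[OF \<Gamma>, of n] \<epsilon> by (intro mult_left_mono) auto
    have iX: "integrable W ?X" by (intro integrable_abs Bochner_Integration.integrable_diff integrable_sites integrable_const)
    note [measurable] = borel_measurable_integrable[OF iX]
    have "?P n \<le> prob {w\<in>space W. ?X w \<ge> ?a}" by (rule finite_measure_mono) (use aE in auto)
    also have "\<dots> \<le> expectation ?X / ?a"
      by (rule integral_Markov_inequality_measure[OF iX, of "{}"]) (use a in auto)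
    also have "\<dots> \<le> 2 * (real (n+1) * e + real m + C * sqrt (real (n+1))) / ?a"
      using a by (intro divide_right_mono dev) auto
    also have "\<dots> = (4 * \<Gamma> / \<epsilon>) * e + (4 * \<Gamma> / \<epsilon>) * (real m / real (n+1) + C * (sqrt (real (n+1)) / real (n+1)))"
      using \<epsilon> \<Gamma>(2) by (simp add: divide_simps) (simp add: algebra_simps)
    also have "sqrt (real (n+1)) / real (n+1) = 1 / sqrt (real (n+1))" by (simp only: sqrt_divide_self_eq of_nat_0_le_iff inverse_eq_divide)
    also have "(4 * \<Gamma> / \<epsilon>) * e = \<delta> / 2" using \<epsilon> \<Gamma>(2) by (simp add: e_def)
    finally show ?thesis by simp
  qed
  have "?r \<longlonglongrightarrow> 0" by real_asymp
  then have "eventually (\<lambda>n. ?r n < \<delta> / 2) sequentially" by (rule order_tendstoD) (use \<delta> in simp)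
  then obtain N where N: "\<And>n. n \<ge> N \<Longrightarrow> ?r n < \<delta> / 2" unfolding eventually_sequentially by blast
  have "norm (?P n - 0) < \<delta>" if "n \<ge> N" for n
  proof -
    have "?P n < \<delta>" using bound[of n] N[OF that] by linarith
    then show ?thesis by simp
  qed
  then show "\<exists>N. \<forall>n\<ge>N. norm (?P n - 0) < \<delta>" by blast
qed

end

text \<open>The conditional probabilities prescribe the transitions only after histories of positive
  probability; after the other histories both sides of the product formula vanish.\<close>

lemma rwwis_rw_process:
  assumes "rwwis p W \<xi>"
  shows "rw_process W \<xi> (rw_kernel p)"
proof -
  have p: "jump_probabilities p" and W: "prob_space W"
    and \<xi>: "\<xi> n \<in> measurable W (count_space UNIV)"
    and cond: "\<P>(w in W. \<forall>i\<le>n. \<xi> i w = x i) > 0 \<Longrightarrow> \<P>(w in W. \<xi> (Suc n) w = b \<bar> \<forall>i\<le>n. \<xi> i w = x i) = transition p (x n) b"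
    for n x b
    using assms unfolding rwwis_def by blast+
  interpret prob_space W by (rule W)
  have "markov_process W \<xi> (rw_kernel p)"
  proof
    fix n x b
    note [measurable] = \<xi>
    let ?A = "{w\<in>space W. \<forall>i\<le>n. \<xi> i w = x i}" and ?B = "{w\<in>space W. (\<forall>i\<le>n. \<xi> i w = x i) \<and> \<xi> (Suc n) w = b}"
    show "measure W ?B = measure W ?A * pmf (rw_kernel p (x n)) b"
    proof (cases "measure W ?A > 0")
      case True
      then have "measure W {w\<in>space W. \<xi> (Suc n) w = b \<and> (\<forall>i\<le>n. \<xi> i w = x i)} / measure W ?A = transition p (x n) b"
        using cond[of n x b] by (simp add: cond_prob_def)
      then show ?thesis using True by (simp add: pmf_rw_kernel[OF p] field_simps conj_commute)
    next
      case False
      then have "measure W ?A = 0" using measure_nonneg[of W ?A] by linarith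
      moreover have "measure W ?B \<le> measure W ?A" by (rule finite_measure_mono) auto
      ultimately show ?thesis using measure_nonneg[of W ?B] by simp
    qed
  qed (rule \<xi>)
  then show ?thesis unfolding rw_process_def using walk_kernel_rw_kernel[OF p] by blast
qed

theorem corollary2:
  fixes p :: "int ^ 'd \<Rightarrow> 'e::finite \<Rightarrow> 'e \<Rightarrow> real"
    and \<mu> :: "real ^ 'e"
    and W :: "'w measure"
    and \<xi> :: "nat \<Rightarrow> 'w \<Rightarrow> (int ^ 'd) \<times> 'e"
  assumes "CARD('d) \<ge> 3"
    and "rwwis p W \<xi>"
    and "irreducible_mat (Q_mat p)" and "aperiodic_mat (Q_mat p)"
    and "stationary_distribution (Q_mat p) \<mu>"
    and "trivial_arithmetic p"
    and "zero_mean p \<mu>"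
    and "finite_second_moments p"
    and "invertible (covariance_mat p \<mu>)"
  shows "\<forall>\<epsilon>>0. (\<lambda>n. \<P>(w in W. \<bar>real (sites_visited \<xi> n w) - expected_sites W \<xi> n\<bar>
                               > \<epsilon> * expected_sites W \<xi> n)) \<longlonglongrightarrow> 0"
proof (intro allI impI)
  fix \<epsilon> :: real assume \<epsilon>: "0 < \<epsilon>"
  have p: "jump_probabilities p" using assms(2) by (simp add: rwwis_def)
  interpret rw_process W \<xi> "rw_kernel p" by (rule rwwis_rw_process[OF assms(2)])
  obtain \<Gamma> where \<Gamma>: "0 < \<Gamma>" "\<And>M i x. visits M i x \<le> \<Gamma>"
    using rwwis_transient[OF p assms(1) assms(3) assms(6)] by blast
  show "(\<lambda>n. \<P>(w in W. \<bar>real (sites_visited \<xi> n w) - expected_sites W \<xi> n\<bar> > \<epsilon> * expected_sites W \<xi> n)) \<longlonglongrightarrow> 0"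
    using assms(3,5) unfolding Q_mat_eq_inner_matrix[OF p]
    by (rule weak_law_sites[OF \<Gamma>(2,1) _ _ \<epsilon>])
qed

end
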